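(* Let $Q$ be an additive abelian group and $\mathfrak{g}$ a $Q$-graded Lie algebra over an algebraically closed field $\Bbbk$. Let $W$ be a $Q$-graded simple $\mathfrak{g}$-module such that $\dim(W)<|\Bbbk|$. Then there are a subgroup $P\subset Q$ and a simple $\mathfrak{g}$-module $V$ with a $Q/P$-grading such that $W$ is $Q$-graded isomorphic to $M(Q,P,V)$.
   Context: A $Q$-graded Lie algebra is a Lie algebra $\mathfrak{g}=\bigoplus_{\alpha\in Q}\mathfrak{g}_\alpha$ with $[\mathfrak{g}_\alpha,\mathfrak{g}_\beta]\subset\mathfrak{g}_{\alpha+\beta}$. A $Q$-graded $\mathfrak{g}$-module is a $\mathfrak{g}$-module $W=\bigoplus_{\alpha\in Q}W_\alpha$ with $\mathfrak{g}_\alpha W_\beta\subset W_{\alpha+\beta}$. It is graded simple if $\mathfrak{g}W\neq0$ and $W$ has no graded submodule other than $0$ and $W$. Two $Q$-graded modules $W,W'$ are $Q$-graded isomorphic if there are $\beta\in Q$ and a $\mathfrak{g}$-module isomorphism $\sigma:W\to W'$ with $\sigma(W_\alpha)=W'_{\alpha+\beta}$ for all $\alpha\in Q$. The inequality $\dim W<|\Bbbk|$ is between cardinals. For a subgroup $P\subset Q$ write $\bar\alpha=\alpha+P$ and view $\mathfrak{g}$ as $Q/P$-graded with $\mathfrak{g}_{\bar\alpha}=\bigoplus_{\beta\in P}\mathfrak{g}_{\alpha+\beta}$. Let $V=\bigoplus_{\bar\alpha\in Q/P}V_{\bar\alpha}$ be a simple $\mathfrak{g}$-module with a $Q/P$-grading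 (compatible with the $Q/P$-grading on $\mathfrak{g}$). Let $\Bbbk Q$ be the group algebra with basis $\{t^\alpha:\alpha\in Q\}$; $V\otimes\Bbbk Q$ is a $\mathfrak{g}$-module via $x\cdot(v\otimes t^\beta)=(xv)\otimes t^{\alpha+\beta}$ for $x\in\mathfrak{g}_\alpha$, $v\in V$, $\beta\in Q$. The loop module is the $Q$-graded $\mathfrak{g}$-module $M(Q,P,V)=\bigoplus_{\alpha\in Q}V_{\bar\alpha}\otimes t^\alpha\subset V\otimes\Bbbk Q$, with $M(Q,P,V)_\alpha=V_{\bar\alpha}\otimes t^\alpha$. *)

theory Defs
  imports
    "HOL-Computational_Algebra.Polynomial"
    "HOL-Library.Poly_Mapping"
    "HOL-Library.Set_Algebras"
begin

unbundle cardinal_syntax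

section \<open>Lie algebras and modules\<close>

text \<open>
  A Lie algebra occupies a whole type. The underlying space of a module is a subspace
  \<open>V\<close> of an ambient vector space; outside \<open>V\<close> nothing is required of the action.
  The field may have any characteristic, so the bracket is required to be alternating.
\<close>

locale lie_algebra = vector_space scaleG
  for scaleG :: "'k::field \<Rightarrow> 'g::ab_group_add \<Rightarrow> 'g" +
  fixes bracket :: "'g \<Rightarrow> 'g \<Rightarrow> 'g"
  assumes bracket_linear_left: "Vector_Spaces.linear scaleG scaleG (\<lambda>x. bracket x y)"
    and bracket_linear_right: "Vector_Spaces.linear scaleG scaleG (\<lambda>y. bracket x y)"
    and bracket_alternating: "bracket x x = 0"
    and jacobi: "bracket x (bracket y z) + bracket y (bracket z x) + bracket z (bracket x y) = 0"

locale lie_module =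
  lie_algebra scaleG bracket + V: vector_space scaleV
  for scaleG :: "'k::field \<Rightarrow> 'g::ab_group_add \<Rightarrow> 'g"
    and bracket :: "'g \<Rightarrow> 'g \<Rightarrow> 'g"
    and scaleV :: "'k \<Rightarrow> 'v::ab_group_add \<Rightarrow> 'v" +
  fixes V :: "'v set"
    and act :: "'g \<Rightarrow> 'v \<Rightarrow> 'v"
  assumes subspace_V: "V.subspace V"
    and act_closed: "v \<in> V \<Longrightarrow> act x v \<in> V"
    and act_add_left: "v \<in> V \<Longrightarrow> act (x + y) v = act x v + act y v"
    and act_scale_left: "v \<in> V \<Longrightarrow> act (scaleG c x) v = scaleV c (act x v)"
    and act_add_right: "v \<in> V \<Longrightarrow> w \<in> V \<Longrightarrow> act x (v + w) = act x v + act x w"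
    and act_scale_right: "v \<in> V \<Longrightarrow> act x (scaleV c v) = scaleV c (act x v)"
    and act_bracket: "v \<in> V \<Longrightarrow> act (bracket x y) v = act x (act y v) - act y (act x v)"

definition lie_submodule ::
  "('k::field \<Rightarrow> 'v::ab_group_add \<Rightarrow> 'v) \<Rightarrow> 'v set \<Rightarrow> ('g \<Rightarrow> 'v \<Rightarrow> 'v) \<Rightarrow> 'v set \<Rightarrow> bool" where
  "lie_submodule scaleV V act U \<longleftrightarrow>
     module.subspace scaleV U \<and> U \<subseteq> V \<and> (\<forall>x. \<forall>u\<in>U. act x u \<in> U)"

locale simple_lie_module = lie_module +
  assumes act_nontrivial: "\<exists>x. \<exists>v\<in>V. act x v \<noteq> 0"
    and submodule_trivial: "lie_submodule scaleV V act U \<Longrightarrow> U = {0} \<or> U = V"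


section \<open>Gradings\<close>

text \<open>
  \<open>V\<close> is the internal direct sum of the subspaces \<open>D i\<close>, \<open>i \<in> I\<close>; the finitely supported
  \<open>c\<close> is the family of components of \<open>v\<close>.
\<close>

definition internal_direct_sum ::
  "('k::field \<Rightarrow> 'v::ab_group_add \<Rightarrow> 'v) \<Rightarrow> 'v set \<Rightarrow> 'i set \<Rightarrow> ('i \<Rightarrow> 'v set) \<Rightarrow> bool" where
  "internal_direct_sum scaleV V I D \<longleftrightarrow>
     (\<forall>i\<in>I. module.subspace scaleV (D i) \<and> D i \<subseteq> V) \<and>
     (\<forall>v\<in>V. \<exists>!c :: 'i \<Rightarrow>\<^sub>0 'v. Poly_Mapping.keys c \<subseteq> I \<and> (\<forall>i\<in>I. Poly_Mapping.lookup c i \<in> D i) \<and>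
        (\<Sum>i\<in>Poly_Mapping.keys c. Poly_Mapping.lookup c i) = v)"

text \<open>
  The grading group is \<open>I\<close> with the addition of its type: either all of \<open>Q\<close>, or \<open>Q/P\<close> as a set
  of cosets, whose addition is the elementwise addition of sets.
\<close>

locale graded_lie_algebra = lie_algebra scaleG bracket
  for scaleG :: "'k::field \<Rightarrow> 'g::ab_group_add \<Rightarrow> 'g"
    and bracket :: "'g \<Rightarrow> 'g \<Rightarrow> 'g" +
  fixes I :: "'i::plus set"
    and G :: "'i \<Rightarrow> 'g set"
  assumes decomposition_G: "internal_direct_sum scaleG UNIV I G"
    and bracket_degree:
      "\<lbrakk>i \<in> I; j \<in> I; x \<in> G i; y \<in> G j\<rbrakk> \<Longrightarrow> bracket x y \<in> G (i + j)"

locale graded_lie_module = lie_module scaleG bracket scaleV V act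
  for scaleG :: "'k::field \<Rightarrow> 'g::ab_group_add \<Rightarrow> 'g"
    and bracket :: "'g \<Rightarrow> 'g \<Rightarrow> 'g"
    and scaleV :: "'k \<Rightarrow> 'v::ab_group_add \<Rightarrow> 'v"
    and V :: "'v set"
    and act :: "'g \<Rightarrow> 'v \<Rightarrow> 'v" +
  fixes I :: "'i::plus set"
    and G :: "'i \<Rightarrow> 'g set"
    and D :: "'i \<Rightarrow> 'v set"
  assumes decomposition_V: "internal_direct_sum scaleV V I D"
    and act_degree: "\<lbrakk>i \<in> I; j \<in> I; x \<in> G i; v \<in> D j\<rbrakk> \<Longrightarrow> act x v \<in> D (i + j)"

definition graded_lie_submodule ::
  "('k::field \<Rightarrow> 'v::ab_group_add \<Rightarrow> 'v) \<Rightarrow> 'v set \<Rightarrow> ('g \<Rightarrow> 'v \<Rightarrow> 'v) \<Rightarrow>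
   'i set \<Rightarrow> ('i \<Rightarrow> 'v set) \<Rightarrow> 'v set \<Rightarrow> bool" where
  "graded_lie_submodule scaleV V act I D U \<longleftrightarrow>
     lie_submodule scaleV V act U \<and> internal_direct_sum scaleV U I (\<lambda>i. U \<inter> D i)"

locale graded_simple_lie_module = graded_lie_module +
  assumes act_nontrivial: "\<exists>x. \<exists>v\<in>V. act x v \<noteq> 0"
    and graded_submodule_trivial:
      "graded_lie_submodule scaleV V act I D U \<Longrightarrow> U = {0} \<or> U = V"

definition lie_module_isomorphism ::
  "('k::field \<Rightarrow> 'v::ab_group_add \<Rightarrow> 'v) \<Rightarrow> 'v set \<Rightarrow> ('g \<Rightarrow> 'v \<Rightarrow> 'v) \<Rightarrow>
   ('k \<Rightarrow> 'w::ab_group_add \<Rightarrow> 'w) \<Rightarrow> 'w set \<Rightarrow> ('g \<Rightarrow> 'w \<Rightarrow> 'w) \<Rightarrow> ('v \<Rightarrow> 'w) \<Rightarrow> bool" where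
  "lie_module_isomorphism scaleV V actV scaleW W actW \<sigma> \<longleftrightarrow>
     bij_betw \<sigma> V W \<and>
     (\<forall>u\<in>V. \<forall>v\<in>V. \<sigma> (u + v) = \<sigma> u + \<sigma> v) \<and>
     (\<forall>c. \<forall>v\<in>V. \<sigma> (scaleV c v) = scaleW c (\<sigma> v)) \<and>
     (\<forall>x. \<forall>v\<in>V. \<sigma> (actV x v) = actW x (\<sigma> v))"

definition graded_isomorphic ::
  "('k::field \<Rightarrow> 'v::ab_group_add \<Rightarrow> 'v) \<Rightarrow> 'v set \<Rightarrow> ('g \<Rightarrow> 'v \<Rightarrow> 'v) \<Rightarrow> ('q::ab_group_add \<Rightarrow> 'v set) \<Rightarrow>
   ('k \<Rightarrow> 'w::ab_group_add \<Rightarrow> 'w) \<Rightarrow> 'w set \<Rightarrow> ('g \<Rightarrow> 'w \<Rightarrow> 'w) \<Rightarrow> ('q \<Rightarrow> 'w set) \<Rightarrow> bool" where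
  "graded_isomorphic scaleV V actV D scaleW W actW E \<longleftrightarrow>
     (\<exists>\<beta> \<sigma>. lie_module_isomorphism scaleV V actV scaleW W actW \<sigma> \<and>
        (\<forall>\<alpha>. \<sigma> ` D \<alpha> = E (\<alpha> + \<beta>)))"


section \<open>Quotients of the grading group\<close>

definition is_subgroup :: "'q::ab_group_add set \<Rightarrow> bool" where
  "is_subgroup P \<longleftrightarrow> 0 \<in> P \<and> (\<forall>a\<in>P. \<forall>b\<in>P. a + b \<in> P) \<and> (\<forall>a\<in>P. - a \<in> P)"

definition quotient_group :: "'q::ab_group_add set \<Rightarrow> 'q set set" where
  "quotient_group P = (\<lambda>\<alpha>. \<alpha> +o P) ` UNIV"

text \<open>The sum of the \<open>G \<gamma>\<close> over \<open>\<gamma> \<in> A\<close>; for \<open>A = \<alpha> +o P\<close> it is the component of degree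
  \<open>A\<close> in the induced \<open>Q/P\<close>-grading.\<close>

definition coarsened_grading ::
  "('k::field \<Rightarrow> 'g::ab_group_add \<Rightarrow> 'g) \<Rightarrow> ('q \<Rightarrow> 'g set) \<Rightarrow> 'q set \<Rightarrow> 'g set" where
  "coarsened_grading scaleG G A = module.span scaleG (\<Union>\<gamma>\<in>A. G \<gamma>)"


section \<open>Loop modules\<close>

text \<open>
  The tensor product of \<open>V\<close> with the group algebra of \<open>Q\<close> is represented by finitely supported
  functions from \<open>Q\<close> to \<open>V\<close>: \<open>Poly_Mapping.single \<beta> v\<close> is the tensor of \<open>v\<close> and the basis vector
  \<open>t\<^sup>\<beta>\<close>.
\<close>

definition homogeneous_components :: "('q \<Rightarrow> 'g::ab_group_add set) \<Rightarrow> 'g \<Rightarrow> 'q \<Rightarrow>\<^sub>0 'g" where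
  "homogeneous_components G x =
     (THE c. (\<forall>\<alpha>. Poly_Mapping.lookup c \<alpha> \<in> G \<alpha>) \<and> (\<Sum>\<alpha>\<in>Poly_Mapping.keys c. Poly_Mapping.lookup c \<alpha>) = x)"

definition loop_scale ::
  "('k \<Rightarrow> 'v::ab_group_add \<Rightarrow> 'v) \<Rightarrow> 'k \<Rightarrow> ('q \<Rightarrow>\<^sub>0 'v) \<Rightarrow> ('q \<Rightarrow>\<^sub>0 'v)" where
  "loop_scale scaleV c = Poly_Mapping.map (scaleV c)"

text \<open>The bilinear extension of the rule \<open>loop_act_single\<close> below.\<close>

definition loop_act ::
  "('q::ab_group_add \<Rightarrow> 'g::ab_group_add set) \<Rightarrow> ('g \<Rightarrow> 'v::ab_group_add \<Rightarrow> 'v) \<Rightarrow>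
   'g \<Rightarrow> ('q \<Rightarrow>\<^sub>0 'v) \<Rightarrow> ('q \<Rightarrow>\<^sub>0 'v)" where
  "loop_act G act x f =
     (\<Sum>\<alpha>\<in>Poly_Mapping.keys (homogeneous_components G x). \<Sum>\<beta>\<in>Poly_Mapping.keys f.
        Poly_Mapping.single (\<alpha> + \<beta>) (act (Poly_Mapping.lookup (homogeneous_components G x) \<alpha>) (Poly_Mapping.lookup f \<beta>)))"

definition loop_carrier ::
  "'q::ab_group_add set \<Rightarrow> ('q set \<Rightarrow> 'v::ab_group_add set) \<Rightarrow> ('q \<Rightarrow>\<^sub>0 'v) set" where
  "loop_carrier P D = {f. \<forall>\<alpha>. Poly_Mapping.lookup f \<alpha> \<in> D (\<alpha> +o P)}"

definition loop_grading ::
  "'q::ab_group_add set \<Rightarrow> ('q set \<Rightarrow> 'v::ab_group_add set) \<Rightarrow> 'q \<Rightarrow> ('q \<Rightarrow>\<^sub>0 'v) set" where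
  "loop_grading P D \<alpha> = Poly_Mapping.single \<alpha> ` D (\<alpha> +o P)"

lemma homogeneous_components_homogeneous:
  fixes G :: "'q::ab_group_add \<Rightarrow> 'g::ab_group_add set"
  assumes "graded_lie_algebra scaleG bracket UNIV G" and "x \<in> G \<alpha>"
  shows "homogeneous_components G x = Poly_Mapping.single \<alpha> x"
proof -
  interpret graded_lie_algebra scaleG bracket UNIV G by fact
  have zero: "0 \<in> G \<gamma>" for \<gamma>
    using decomposition_G subspace_0 by (auto simp: internal_direct_sum_def)
  have "\<exists>!c :: 'q \<Rightarrow>\<^sub>0 'g. (\<forall>\<gamma>. Poly_Mapping.lookup c \<gamma> \<in> G \<gamma>) \<and> (\<Sum>\<gamma>\<in>Poly_Mapping.keys c. Poly_Mapping.lookup c \<gamma>) = x"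
    using decomposition_G by (simp add: internal_direct_sum_def)
  then show ?thesis
    unfolding homogeneous_components_def
    by (rule the1_equality) (use assms(2) zero in \<open>auto simp: lookup_single when_def\<close>)
qed

lemma loop_act_single:
  assumes "graded_lie_algebra scaleG bracket UNIV G"
    and "lie_module scaleG bracket scaleV V act"
    and "x \<in> G \<alpha>" "v \<in> V"
  shows "loop_act G act x (Poly_Mapping.single \<beta> v) = Poly_Mapping.single (\<alpha> + \<beta>) (act x v)"
proof -
  interpret lie_module scaleG bracket scaleV V act by fact
  have "act 0 v = 0" "act x 0 = 0"
    using act_add_left[OF \<open>v \<in> V\<close>, of 0 0] act_add_right[of 0 0 x] V.subspace_0[OF subspace_V]
    by simp_all
  then show ?thesis
    by (simp add: loop_act_def homogeneous_components_homogeneous[OF assms(1,3)])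
qed


section \<open>Dimension\<close>

text \<open>The dimension of a possibly infinite-dimensional space, as the cardinality of a basis
  (\<open>extend_basis {}\<close> is a basis of the whole space).\<close>

definition cardinal_dim :: "('k::field \<Rightarrow> 'v::ab_group_add \<Rightarrow> 'v) \<Rightarrow> 'v rel" where
  "cardinal_dim scaleV = |vector_space.extend_basis scaleV {}|"

end

theory Submission
  imports Defs
begin

text \<open>
  The obstruction to \<open>W\<close> being simple as an ungraded module is its graded endomorphism algebra.
  Let \<open>homs \<gamma>\<close> be the module endomorphisms of \<open>W\<close> that raise degrees by \<open>\<gamma>\<close>. Kernel and image of
  such a map are graded submodules, so a nonzero one is bijective (\<open>hom_bij\<close>). The bound on the
  dimension makes every element \<open>\<phi>\<close> of \<open>homs 0\<close> a scalar (\<open>hom_0_scalar\<close>): otherwise all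
  \<open>\<phi> - c\<close> would be invertible, and the vectors \<open>(\<phi> - c)\<inverse> w\<close>, one for each scalar \<open>c\<close>, would be
  linearly independent. Hence every \<open>homs \<gamma>\<close> is at most one-dimensional, and the graded
  endomorphisms form a twisted group algebra, which need not be commutative.

  By Zorn's lemma there is a maximal commutative monoid \<open>M\<close> of homogeneous automorphisms containing
  at most one multiple of each of its elements. Since the field has all roots, any
  homogeneous automorphism that commutes with \<open>M\<close> has a multiple in \<open>M\<close>
  (\<open>maximal_family_absorbs\<close>). It follows that \<open>M\<close> is a group, isomorphic by the degree map to a
  subgroup \<open>P\<close> of \<open>Q\<close> (\<open>degrees\<close> below).

  The module \<open>V\<close> is the quotient of \<open>W\<close> by all \<open>u w - w\<close> with \<open>u \<in> M\<close>. Each element of \<open>M\<close> identifies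
  two components of \<open>W\<close> whose degrees differ by an element of \<open>P\<close>, so \<open>V\<close> is graded by \<open>Q/P\<close>, and
  its component of degree \<open>\<alpha> + P\<close> is a copy of the component of \<open>W\<close> of degree \<open>\<alpha>\<close>. This already
  gives the isomorphism of \<open>W\<close> with the loop module of \<open>V\<close>, which sends \<open>w\<close> of degree \<open>\<alpha>\<close> to the
  class of \<open>w\<close> tensored with \<open>t\<^sup>\<alpha>\<close>. Concretely, one degree is picked in each coset of
  \<open>P\<close>, and the quotient is realised inside \<open>W\<close> as the sum of the components of these degrees, with
  a projection \<open>\<pi>\<close> of \<open>W\<close> onto it.

  For the simplicity of \<open>V\<close>, consider a nonzero submodule \<open>N\<close> and a nonzero vector in it with support
  of minimal size. If the support contains two degrees \<open>s\<close> and \<open>s'\<close>, then minimality implies that in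
  all vectors of \<open>N\<close> whose support is a translate of the given one the component at \<open>s\<close> determines the
  component at \<open>s'\<close>. This correspondence is a homogeneous endomorphism of \<open>W\<close> of degree \<open>s' - s\<close> that
  commutes with \<open>M\<close> (\<open>window_transition\<close>). So \<open>s' - s\<close> is in \<open>P\<close>, which is impossible for
  two different chosen degrees. Therefore \<open>N\<close> contains a homogeneous vector, and graded simplicity of
  \<open>W\<close> gives \<open>N = V\<close>.
\<close>

section \<open>Operators without eigenvalues\<close>

lemma (in vector_space) independent_ordLeq_cardinal_dim:
  assumes "independent B"
  shows "|B| \<le>o cardinal_dim scale"
proof -
  have "\<exists>f. bij_betw f (extend_basis B) (extend_basis {})"
    by (rule bij_if_span_eq_span_bases)
      (simp_all add: assms independent_extend_basis span_extend_basis independent_empty)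
  then have "|extend_basis B| =o |extend_basis {}|"
    by (simp add: card_of_ordIso)
  moreover have "|B| \<le>o |extend_basis B|"
    by (rule card_of_mono1) (rule extend_basis_superset[OF assms])
  ultimately show ?thesis
    unfolding cardinal_dim_def by (rule ordLeq_ordIso_trans[rotated])
qed

locale linear_operator = vector_space scaleV
  for scaleV :: "'k::field \<Rightarrow> 'v::ab_group_add \<Rightarrow> 'v" +
  fixes \<phi> :: "'v \<Rightarrow> 'v"
  assumes add: "\<phi> (v + w) = \<phi> v + \<phi> w"
    and scale: "\<phi> (scaleV c v) = scaleV c (\<phi> v)"
begin

definition poly_apply :: "'k poly \<Rightarrow> 'v \<Rightarrow> 'v" where
  "poly_apply p v = fold_coeffs (\<lambda>a x. scaleV a v + \<phi> x) p 0"

lemma zero [simp]: "\<phi> 0 = 0"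
  using add[of 0 0] by simp

lemma poly_apply_0: "poly_apply 0 v = 0"
  by (simp add: poly_apply_def)

lemma poly_apply_pCons: "poly_apply (pCons a p) v = scaleV a v + \<phi> (poly_apply p v)"
  by (cases "p = 0"; cases "a = 0") (simp_all add: poly_apply_def)

lemma poly_apply_arg_0: "poly_apply p 0 = 0"
  using add[of 0 0] by (induction p) (simp_all add: poly_apply_0 poly_apply_pCons)

lemma poly_apply_add: "poly_apply (p + q) v = poly_apply p v + poly_apply q v"
  by (induction p q rule: poly_induct2)
    (simp_all add: poly_apply_0 poly_apply_pCons add scale_left_distrib)

lemma poly_apply_smult: "poly_apply (smult c p) v = scaleV c (poly_apply p v)"
  by (induction p) (simp_all add: poly_apply_0 poly_apply_pCons scale scale_right_distrib)

lemma poly_apply_mult: "poly_apply (p * q) v = poly_apply p (poly_apply q v)"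
  by (induction p)
    (simp_all add: poly_apply_0 poly_apply_pCons poly_apply_add poly_apply_smult)

lemma poly_apply_sum: "poly_apply (sum f A) v = (\<Sum>a\<in>A. poly_apply (f a) v)"
  by (induction A rule: infinite_finite_induct) (simp_all add: poly_apply_0 poly_apply_add)

lemma poly_apply_arg_sum: "poly_apply p (sum f A) = (\<Sum>a\<in>A. poly_apply p (f a))"
proof -
  have "poly_apply p (v + w) = poly_apply p v + poly_apply p w" for v w
    by (induction p) (simp_all add: poly_apply_0 poly_apply_pCons add scale_right_distrib)
  then show ?thesis
    by (induction A rule: infinite_finite_induct) (simp_all add: poly_apply_arg_0)
qed

lemma poly_apply_arg_scale: "poly_apply p (scaleV c v) = scaleV c (poly_apply p v)"
  by (induction p)
    (simp_all add: poly_apply_0 poly_apply_pCons scale scale_right_distrib mult.commute)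

lemma poly_apply_linear: "poly_apply [:- c, 1:] v = \<phi> v - scaleV c v"
  using add[of 0 0] by (simp add: poly_apply_0 poly_apply_pCons)

end

text \<open>
  The vectors \<open>r c = (\<phi> - c)\<inverse> w\<close> are linearly independent. Multiplying a relation
  between them by \<open>\<Prod>(\<phi> - c)\<close> turns it into \<open>f(\<phi>) w = 0\<close> for a polynomial \<open>f\<close>. As \<open>f\<close> splits into
  linear factors, \<open>f(\<phi>)\<close> is injective unless \<open>f = 0\<close>, and evaluating \<open>f\<close> at the scalars \<open>c\<close> recovers the
  coefficients of the relation up to nonzero factors.
\<close>

lemma UNIV_ordLeq_cardinal_dim_if_no_eigenvalue:
  fixes scaleV :: "'k::alg_closed_field \<Rightarrow> 'v::ab_group_add \<Rightarrow> 'v"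
    and \<phi> :: "'v \<Rightarrow> 'v" and w :: 'v
  assumes "vector_space scaleV"
    and add: "\<And>v w. \<phi> (v + w) = \<phi> v + \<phi> w"
    and scale: "\<And>c v. \<phi> (scaleV c v) = scaleV c (\<phi> v)"
    and bij: "\<And>c. bij (\<lambda>v. \<phi> v - scaleV c v)"
    and "w \<noteq> 0"
  shows "|UNIV :: 'k set| \<le>o cardinal_dim scaleV"
proof -
  interpret vector_space scaleV by fact
  interpret linear_operator scaleV \<phi>
    by unfold_locales (fact add scale)+
  note ap = poly_apply_0 poly_apply_pCons poly_apply_mult poly_apply_linear
    poly_apply_arg_sum poly_apply_arg_scale
  have nonzero: "poly_apply p v \<noteq> 0" if "p \<noteq> 0" "v \<noteq> 0" for p v
    using that
  proof (induction "degree p" arbitrary: p)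
    case 0
    then obtain a where "p = [:a:]" "a \<noteq> 0"
      by (metis degree_eq_zeroE pCons_0_0)
    with 0 show ?case by (simp add: ap)
  next
    case (Suc n)
    then obtain c where "poly p c = 0"
      using alg_closed_imp_poly_has_root[of p] by auto
    then obtain q where q: "p = [:- c, 1:] * q"
      by (auto simp: poly_eq_0_iff_dvd)
    have "q \<noteq> 0" using q Suc.prems(1) by auto
    then have "degree p = degree [:- c, 1:] + degree q"
      unfolding q by (intro degree_mult_eq) simp_all
    then have "degree q = n" using Suc.hyps(2) by simp
    with Suc \<open>q \<noteq> 0\<close> have "poly_apply q v \<noteq> 0" by blast
    then have "\<phi> (poly_apply q v) - scaleV c (poly_apply q v) \<noteq> 0"
      using inj_eq[OF bij_is_inj[OF bij[of c]], of "poly_apply q v" 0] by simp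
    then show ?case by (simp only: q poly_apply_mult poly_apply_linear not_False_eq_True)
  qed
  define r where "r c = inv (\<lambda>v. \<phi> v - scaleV c v) w" for c
  have r: "poly_apply [:- c, 1:] (r c) = w" for c
    using surj_f_inv_f[OF bij_is_surj[OF bij]] by (simp only: poly_apply_linear r_def)
  have coefficients_0: "a d = 0"
    if F: "finite F" "d \<in> F" and sum: "(\<Sum>c\<in>F. scaleV (a c) (r c)) = 0" for a F d
  proof -
    define p where "p A = (\<Prod>c\<in>A. [:- c, 1:])" for A :: "'k set"
    have p: "poly_apply (p F) (r c) = poly_apply (p (F - {c})) w" if "c \<in> F" for c
    proof -
      have "p F = p (F - {c}) * [:- c, 1:]"
        unfolding p_def by (subst prod.remove[OF F(1) that]) (simp only: mult.commute)
      then show ?thesis by (simp only: poly_apply_mult r)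
    qed
    have "0 = poly_apply (p F) (\<Sum>c\<in>F. scaleV (a c) (r c))"
      unfolding sum by (simp add: poly_apply_arg_0)
    also have "\<dots> = (\<Sum>c\<in>F. scaleV (a c) (poly_apply (p (F - {c})) w))"
      by (simp add: ap p)
    also have "\<dots> = poly_apply (\<Sum>c\<in>F. smult (a c) (p (F - {c}))) w"
      by (simp add: poly_apply_sum poly_apply_smult)
    finally have "(\<Sum>c\<in>F. smult (a c) (p (F - {c}))) = 0"
      using nonzero \<open>w \<noteq> 0\<close> by metis
    then have "0 = poly (\<Sum>c\<in>F. smult (a c) (p (F - {c}))) d" by simp
    also have "\<dots> = (\<Sum>c\<in>F. a c * (\<Prod>e\<in>F - {c}. d - e))"
      by (simp add: poly_sum p_def poly_prod)
    also have "\<dots> = a d * (\<Prod>e\<in>F - {d}. d - e)"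
    proof -
      have "a c * (\<Prod>e\<in>F - {c}. d - e) = 0" if "c \<in> F - {d}" for c
        using F that by (auto intro!: prod_zero)
      then show ?thesis
        by (subst sum.remove[OF F]) (simp add: sum.neutral)
    qed
    finally show ?thesis using F(1) by auto
  qed
  have inj: "inj r"
  proof (rule injI, rule ccontr)
    fix c d assume "r c = r d" "c \<noteq> d"
    then show False
      using coefficients_0[of "{c, d}" c "\<lambda>e. if e = c then 1 else - 1"] by auto
  qed
  have "independent (range r)"
    unfolding independent_explicit_finite_subsets
  proof (intro allI impI ballI)
    fix S u v
    assume S: "S \<subseteq> range r" "finite S" and sum: "(\<Sum>v\<in>S. scaleV (u v) v) = 0" and "v \<in> S"
    then obtain F where F: "S = r ` F" by (auto simp: subset_image_iff)
    have inj_F: "inj_on r F" using inj by (rule inj_on_subset) simp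
    then have "finite F" using S F by (simp add: finite_image_iff)
    moreover have "(\<Sum>c\<in>F. scaleV (u (r c)) (r c)) = 0"
      using sum unfolding F by (simp add: sum.reindex[OF inj_F])
    ultimately show "u v = 0"
      using \<open>v \<in> S\<close> coefficients_0[of F _ "\<lambda>c. u (r c)"] unfolding F by auto
  qed
  then have "|range r| \<le>o cardinal_dim scaleV" by (rule independent_ordLeq_cardinal_dim)
  moreover have "|UNIV :: 'k set| \<le>o |range r|"
    using inj by (intro card_of_ordLeqI[of r]) auto
  ultimately show ?thesis by (rule ordLeq_transitive[rotated])
qed

section \<open>Internal direct sums\<close>

locale direct_sum_decomposition = vector_space scaleV
  for scaleV :: "'k::field \<Rightarrow> 'v::ab_group_add \<Rightarrow> 'v" +
  fixes D :: "'i \<Rightarrow> 'v set"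
  assumes decomposition: "internal_direct_sum scaleV UNIV UNIV D"
begin

definition component :: "'i \<Rightarrow> 'v \<Rightarrow> 'v" where
  "component \<alpha> v = Poly_Mapping.lookup (homogeneous_components D v) \<alpha>"

definition supp :: "'v \<Rightarrow> 'i set" where
  "supp v = Poly_Mapping.keys (homogeneous_components D v)"

lemma subspace_D: "subspace (D \<alpha>)"
  using decomposition by (simp add: internal_direct_sum_def)

lemma unique_components:
  "\<exists>!c :: 'i \<Rightarrow>\<^sub>0 'v. (\<forall>\<alpha>. Poly_Mapping.lookup c \<alpha> \<in> D \<alpha>) \<and>
     (\<Sum>\<alpha>\<in>Poly_Mapping.keys c. Poly_Mapping.lookup c \<alpha>) = v"
  using decomposition by (simp add: internal_direct_sum_def)

text \<open>
  The uniqueness of the components, in the form that identifies the description operator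
  \<open>homogeneous_components\<close>.
\<close>

lemma homogeneous_components_eqI:
  assumes "\<And>\<alpha>. Poly_Mapping.lookup c \<alpha> \<in> D \<alpha>"
    and "(\<Sum>\<alpha>\<in>Poly_Mapping.keys c. Poly_Mapping.lookup c \<alpha>) = v"
  shows "homogeneous_components D v = c"
  unfolding homogeneous_components_def
  by (rule the1_equality[OF unique_components]) (use assms in auto)

lemma component_in [simp]: "component \<alpha> v \<in> D \<alpha>"
  and sum_components: "(\<Sum>\<alpha>\<in>supp v. component \<alpha> v) = v"
  using theI'[OF unique_components, of v]
  by (auto simp: component_def supp_def homogeneous_components_def[of D v])

lemma finite_supp [simp]: "finite (supp v)"
  by (simp add: supp_def)

lemma in_supp_iff: "\<alpha> \<in> supp v \<longleftrightarrow> component \<alpha> v \<noteq> 0"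
  by (simp add: supp_def component_def in_keys_iff)

lemma sum_components_superset:
  assumes "finite A" "supp v \<subseteq> A"
  shows "(\<Sum>\<alpha>\<in>A. component \<alpha> v) = v"
proof -
  have "(\<Sum>\<alpha>\<in>A. component \<alpha> v) = (\<Sum>\<alpha>\<in>supp v. component \<alpha> v)"
    using assms by (intro sum.mono_neutral_right) (auto simp: in_supp_iff)
  then show ?thesis by (simp add: sum_components)
qed

lemma component_sum_homogeneous:
  assumes "finite A" "\<And>\<alpha>. \<alpha> \<in> A \<Longrightarrow> f \<alpha> \<in> D \<alpha>"
  shows "component \<beta> (\<Sum>\<alpha>\<in>A. f \<alpha>) = (if \<beta> \<in> A then f \<beta> else 0)"
proof -
  define g where "g \<alpha> = (if \<alpha> \<in> A then f \<alpha> else 0)" for \<alpha>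
  have fin: "finite {\<alpha>. g \<alpha> \<noteq> 0}"
    using assms(1) by (rule finite_subset[rotated]) (auto simp: g_def)
  define c where "c = Poly_Mapping.Abs_poly_mapping g"
  have c: "Poly_Mapping.lookup c = g" using fin by (simp add: c_def)
  have keys: "Poly_Mapping.keys c = {\<alpha>. g \<alpha> \<noteq> 0}"
    by (auto simp: c in_keys_iff)
  have "homogeneous_components D (\<Sum>\<alpha>\<in>A. f \<alpha>) = c"
  proof (rule homogeneous_components_eqI)
    show "Poly_Mapping.lookup c \<alpha> \<in> D \<alpha>" for \<alpha>
      using assms(2) subspace_0[OF subspace_D] by (auto simp: c g_def)
    show "(\<Sum>\<alpha>\<in>Poly_Mapping.keys c. Poly_Mapping.lookup c \<alpha>) = (\<Sum>\<alpha>\<in>A. f \<alpha>)"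
      unfolding keys c using assms(1) by (intro sum.mono_neutral_cong_left) (auto simp: g_def)
  qed
  then show ?thesis by (simp add: component_def c g_def)
qed

lemma component_homogeneous: "v \<in> D \<alpha> \<Longrightarrow> component \<beta> v = (if \<beta> = \<alpha> then v else 0)"
  using component_sum_homogeneous[of "{\<alpha>}" "\<lambda>_. v" \<beta>] by simp

lemma supp_homogeneous: "v \<in> D \<alpha> \<Longrightarrow> supp v \<subseteq> {\<alpha>}"
  by (auto simp: in_supp_iff component_homogeneous split: if_splits)

lemma component_add: "component \<beta> (v + w) = component \<beta> v + component \<beta> w"
proof -
  let ?A = "supp v \<union> supp w"
  have "v + w = (\<Sum>\<alpha>\<in>?A. component \<alpha> v + component \<alpha> w)"
    by (simp add: sum.distrib sum_components_superset)
  then have "component \<beta> (v + w) = component \<beta> (\<Sum>\<alpha>\<in>?A. component \<alpha> v + component \<alpha> w)"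
    by simp
  also have "\<dots> = (if \<beta> \<in> ?A then component \<beta> v + component \<beta> w else 0)"
    by (rule component_sum_homogeneous) (auto intro: subspace_add[OF subspace_D])
  finally show ?thesis by (auto simp: in_supp_iff)
qed

lemma component_0 [simp]: "component \<beta> 0 = 0"
  using component_add[of \<beta> 0 0] by simp

lemma component_scale: "component \<beta> (scaleV c v) = scaleV c (component \<beta> v)"
proof -
  have "component \<beta> (scaleV c v) = component \<beta> (\<Sum>\<alpha>\<in>supp v. scaleV c (component \<alpha> v))"
    by (simp flip: scale_sum_right add: sum_components)
  also have "\<dots> = (if \<beta> \<in> supp v then scaleV c (component \<beta> v) else 0)"
    by (rule component_sum_homogeneous) (auto intro: subspace_scale[OF subspace_D])
  finally show ?thesis by (auto simp: in_supp_iff)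
qed

lemma component_sum: "component \<beta> (sum f A) = (\<Sum>a\<in>A. component \<beta> (f a))"
  by (induction A rule: infinite_finite_induct) (simp_all add: component_add)

lemma components_eqI:
  assumes "\<And>\<alpha>. component \<alpha> v = component \<alpha> w"
  shows "v = w"
proof -
  have "supp v = supp w" using assms by (auto simp: in_supp_iff)
  then have "(\<Sum>\<alpha>\<in>supp v. component \<alpha> v) = (\<Sum>\<alpha>\<in>supp w. component \<alpha> w)"
    by (intro sum.cong assms)
  then show ?thesis by (simp only: sum_components)
qed

lemma supp_empty_iff: "supp v = {} \<longleftrightarrow> v = 0"
proof
  assume "supp v = {}"
  then show "v = 0" using sum_components[of v] by simp
qed (auto simp: in_supp_iff)

lemma supp_add: "supp (v + w) \<subseteq> supp v \<union> supp w"
  by (auto simp: in_supp_iff component_add)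

lemma supp_scale: "supp (scaleV c v) \<subseteq> supp v"
  by (auto simp: in_supp_iff component_scale)

lemma homogeneous_induct [case_names homogeneous add]:
  assumes "\<And>\<alpha> v. v \<in> D \<alpha> \<Longrightarrow> Q v"
    and "\<And>v w. Q v \<Longrightarrow> Q w \<Longrightarrow> Q (v + w)"
  shows "Q v"
proof -
  have Q_0: "Q 0" by (rule assms(1)) (rule subspace_0[OF subspace_D])
  have "Q (\<Sum>\<alpha>\<in>A. component \<alpha> v)" if "finite A" for A
    using that
    by (induction A rule: finite_induct) (simp_all add: Q_0 assms(2) assms(1)[OF component_in])
  then show ?thesis by (metis sum_components finite_supp)
qed

text \<open>
  The index map \<open>h\<close> may be non-injective, because the projection onto the quotient module moves every
  degree to the chosen degree of its coset; several components can then be added up.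
\<close>

lemma component_image:
  assumes add: "\<And>v w. f (v + w) = f v + f w"
    and shift: "\<And>\<alpha> v. v \<in> D \<alpha> \<Longrightarrow> f v \<in> D (h \<alpha>)"
  shows "component \<beta> (f v) = (\<Sum>\<alpha> | \<alpha> \<in> supp v \<and> h \<alpha> = \<beta>. f (component \<alpha> v))"
proof -
  have "f 0 = 0" using add[of 0 0] by simp
  then have f_sum: "f (sum g A) = (\<Sum>a\<in>A. f (g a))" for g :: "'i \<Rightarrow> 'v" and A
    by (induction A rule: infinite_finite_induct) (simp_all add: add)
  have "component \<beta> (f v) = (\<Sum>\<alpha>\<in>supp v. component \<beta> (f (component \<alpha> v)))"
    using sum_components[of v] by (metis f_sum component_sum)
  also have "\<dots> = (\<Sum>\<alpha>\<in>supp v. if h \<alpha> = \<beta> then f (component \<alpha> v) else 0)"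
    by (intro sum.cong refl) (auto simp: component_homogeneous[OF shift[OF component_in]])
  also have "\<dots> = (\<Sum>\<alpha> | \<alpha> \<in> supp v \<and> h \<alpha> = \<beta>. f (component \<alpha> v))"
    by (simp add: sum.inter_filter)
  finally show ?thesis .
qed

lemma supp_image:
  assumes "\<And>v w. f (v + w) = f v + f w"
    and "\<And>\<alpha> v. v \<in> D \<alpha> \<Longrightarrow> f v \<in> D (h \<alpha>)"
  shows "supp (f v) \<subseteq> h ` supp v"
proof
  fix \<beta> assume "\<beta> \<in> supp (f v)"
  then have "(\<Sum>\<alpha> | \<alpha> \<in> supp v \<and> h \<alpha> = \<beta>. f (component \<alpha> v)) \<noteq> 0"
    using component_image[of f h, OF assms] by (simp add: in_supp_iff)
  then show "\<beta> \<in> h ` supp v"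
    by (auto elim: sum.not_neutral_contains_not_neutral)
qed

lemma component_image_inj:
  assumes add: "\<And>v w. f (v + w) = f v + f w"
    and shift: "\<And>\<alpha> v. v \<in> D \<alpha> \<Longrightarrow> f v \<in> D (h \<alpha>)"
    and inj: "inj_on h (insert \<alpha> (supp v))"
  shows "component (h \<alpha>) (f v) = f (component \<alpha> v)"
proof -
  have "{\<alpha>'. \<alpha>' \<in> supp v \<and> h \<alpha>' = h \<alpha>} = (if \<alpha> \<in> supp v then {\<alpha>} else {})"
    using inj by (auto simp: inj_on_def)
  moreover have "f 0 = 0" using add[of 0 0] by simp
  ultimately show ?thesis
    by (auto simp: component_image[of f h, OF add shift] in_supp_iff)
qed

text \<open>
  The map on the whole space that is given by \<open>f \<alpha>\<close> on the component \<open>D \<alpha>\<close>.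
\<close>

definition glue :: "('i \<Rightarrow> 'v \<Rightarrow> 'u) \<Rightarrow> 'v \<Rightarrow> 'u::ab_group_add" where
  "glue f v = (\<Sum>\<alpha>\<in>supp v. f \<alpha> (component \<alpha> v))"

lemma glue_homogeneous:
  assumes "f \<alpha> 0 = 0" "v \<in> D \<alpha>"
  shows "glue f v = f \<alpha> v"
proof -
  have "glue f v = (\<Sum>\<beta>\<in>{\<alpha>}. f \<beta> (component \<beta> v))"
    unfolding glue_def using assms
    by (intro sum.mono_neutral_left supp_homogeneous) (auto simp: in_supp_iff)
  then show ?thesis using assms(2) by (simp add: component_homogeneous)
qed

lemma glue_add:
  assumes add: "\<And>\<alpha> v w. v \<in> D \<alpha> \<Longrightarrow> w \<in> D \<alpha> \<Longrightarrow> f \<alpha> (v + w) = f \<alpha> v + f \<alpha> w"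
  shows "glue f (v + w) = glue f v + glue f w"
proof -
  have f_0: "f \<alpha> 0 = 0" for \<alpha>
    using add[of 0 \<alpha> 0] subspace_0[OF subspace_D] by simp
  have glue_superset: "glue f u = (\<Sum>\<alpha>\<in>A. f \<alpha> (component \<alpha> u))"
    if "finite A" "supp u \<subseteq> A" for A u
    unfolding glue_def using that by (intro sum.mono_neutral_left) (auto simp: in_supp_iff f_0)
  let ?A = "supp v \<union> supp w"
  show ?thesis
    by (simp add: glue_superset[of ?A] supp_add component_add add sum.distrib)
qed

text \<open>
  Used with the identity for graded submodules, and with the choice of a degree in each coset for the
  grading of the quotient module by cosets.
\<close>

lemma internal_direct_sum_reindex:
  assumes "subspace U" "inj_on h J"
    and components: "\<And>v \<alpha>. v \<in> U \<Longrightarrow> component \<alpha> v \<in> U"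
    and supp: "\<And>v. v \<in> U \<Longrightarrow> supp v \<subseteq> h ` J"
  shows "internal_direct_sum scaleV U J (\<lambda>j. U \<inter> D (h j))"
  unfolding internal_direct_sum_def
proof (intro conjI ballI)
  show "subspace (U \<inter> D (h j))" "U \<inter> D (h j) \<subseteq> U" for j
    using assms(1) subspace_D by (auto intro: subspace_inter)
  fix v assume "v \<in> U"
  define g where "g j = (if j \<in> J then component (h j) v else 0)" for j
  have "finite {j \<in> J. h j \<in> supp v}"
    using assms(2) by (intro finite_imageD[of h]) (auto intro: finite_subset[of _ "supp v"] inj_on_subset)
  then have fin: "finite {j. g j \<noteq> 0}"
    by (rule finite_subset[rotated]) (auto simp: g_def in_supp_iff split: if_splits)
  define c where "c = Poly_Mapping.Abs_poly_mapping g"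
  have c: "Poly_Mapping.lookup c = g" using fin by (simp add: c_def)
  have keys: "Poly_Mapping.keys c = {j \<in> J. h j \<in> supp v}"
    by (auto simp: c in_keys_iff g_def in_supp_iff split: if_splits)
  show "\<exists>!c. Poly_Mapping.keys c \<subseteq> J \<and> (\<forall>j\<in>J. Poly_Mapping.lookup c j \<in> U \<inter> D (h j)) \<and>
    (\<Sum>j\<in>Poly_Mapping.keys c. Poly_Mapping.lookup c j) = v"
  proof (intro ex1I[of _ c] conjI ballI)
    show "Poly_Mapping.keys c \<subseteq> J" by (auto simp: keys)
    show "Poly_Mapping.lookup c j \<in> U \<inter> D (h j)" if "j \<in> J" for j
      using that components[OF \<open>v \<in> U\<close>] by (simp add: c g_def)
    have "inj_on h {j \<in> J. h j \<in> supp v}" "h ` {j \<in> J. h j \<in> supp v} = supp v"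
      using assms(2) supp[OF \<open>v \<in> U\<close>] by (auto intro: inj_on_subset)
    then have "(\<Sum>j\<in>{j \<in> J. h j \<in> supp v}. component (h j) v) = (\<Sum>\<alpha>\<in>supp v. component \<alpha> v)"
      by (metis (no_types, lifting) sum.reindex_cong)
    then show "(\<Sum>j\<in>Poly_Mapping.keys c. Poly_Mapping.lookup c j) = v"
      by (simp add: keys c g_def sum_components)
  next
    fix d
    assume d: "Poly_Mapping.keys d \<subseteq> J \<and> (\<forall>j\<in>J. Poly_Mapping.lookup d j \<in> U \<inter> D (h j)) \<and>
      (\<Sum>j\<in>Poly_Mapping.keys d. Poly_Mapping.lookup d j) = v"
    have inj: "inj_on h (Poly_Mapping.keys d)"
      using assms(2) d by (auto intro: inj_on_subset)
    show "d = c"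
    proof (rule poly_mapping_eqI)
      fix j
      show "Poly_Mapping.lookup d j = Poly_Mapping.lookup c j"
      proof (cases "j \<in> J")
        case True
        have "component (h j) v = (\<Sum>i\<in>Poly_Mapping.keys d. component (h j) (Poly_Mapping.lookup d i))"
          using d component_sum by metis
        also have "\<dots> = (\<Sum>i\<in>Poly_Mapping.keys d. if i = j then Poly_Mapping.lookup d i else 0)"
        proof (intro sum.cong refl)
          fix i assume "i \<in> Poly_Mapping.keys d"
          then have "i \<in> J" "Poly_Mapping.lookup d i \<in> D (h i)" using d by auto
          moreover have "h j = h i \<longleftrightarrow> i = j"
            using assms(2) True \<open>i \<in> J\<close> by (auto simp: inj_on_def)
          ultimately show "component (h j) (Poly_Mapping.lookup d i)
              = (if i = j then Poly_Mapping.lookup d i else 0)"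
            by (simp add: component_homogeneous)
        qed
        also have "\<dots> = Poly_Mapping.lookup d j"
          by (simp add: in_keys_iff)
        finally show ?thesis using True by (simp add: c g_def)
      next
        case False
        then show ?thesis using d by (auto simp: c g_def in_keys_iff)
      qed
    qed
  qed
qed

end

section \<open>Homogeneous endomorphisms\<close>

locale graded_simple_module =
  graded_lie_algebra scaleG bracket UNIV G +
  graded_simple_lie_module scaleG bracket scaleW UNIV act UNIV G D
  for scaleG :: "'k::field \<Rightarrow> 'g::ab_group_add \<Rightarrow> 'g"
    and bracket :: "'g \<Rightarrow> 'g \<Rightarrow> 'g"
    and G :: "'q::ab_group_add \<Rightarrow> 'g set"
    and scaleW :: "'k \<Rightarrow> 'w::ab_group_add \<Rightarrow> 'w"
    and act :: "'g \<Rightarrow> 'w \<Rightarrow> 'w"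
    and D :: "'q \<Rightarrow> 'w set"
begin

sublocale G: direct_sum_decomposition scaleG G
  by unfold_locales (rule decomposition_G)

sublocale W: direct_sum_decomposition scaleW D
  by unfold_locales (rule decomposition_V)

lemmas act_add = act_add_right[OF UNIV_I UNIV_I]
lemmas act_scale = act_scale_right[OF UNIV_I]
lemmas add_act = act_add_left[OF UNIV_I]
lemmas scale_act = act_scale_left[OF UNIV_I]

lemma act_homogeneous: "x \<in> G \<gamma> \<Longrightarrow> v \<in> D \<alpha> \<Longrightarrow> act x v \<in> D (\<gamma> + \<alpha>)"
  by (rule act_degree) simp_all

text \<open>
  Translation by \<open>\<gamma>\<close> is injective on degrees, so homogeneous operators commute with taking components.
\<close>

lemma component_act:
  "x \<in> G \<gamma> \<Longrightarrow> W.component (\<gamma> + \<alpha>) (act x v) = act x (W.component \<alpha> v)"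
  by (rule W.component_image_inj[of "act x" "(+) \<gamma>"]) (auto simp: act_add intro: act_homogeneous inj_onI)

lemma graded_subspace_trivial:
  assumes "V.subspace U" and "\<And>x u. u \<in> U \<Longrightarrow> act x u \<in> U"
    and "\<And>\<alpha> u. u \<in> U \<Longrightarrow> W.component \<alpha> u \<in> U"
  shows "U = {0} \<or> U = UNIV"
proof (rule graded_submodule_trivial)
  show "graded_lie_submodule scaleW UNIV act UNIV D U"
    using assms W.internal_direct_sum_reindex[of U "\<lambda>\<alpha>. \<alpha>" UNIV]
    by (simp add: graded_lie_submodule_def lie_submodule_def)
qed

definition homs :: "'q \<Rightarrow> ('w \<Rightarrow> 'w) set" where
  "homs \<gamma> = {\<phi>. (\<forall>v w. \<phi> (v + w) = \<phi> v + \<phi> w) \<and> (\<forall>c v. \<phi> (scaleW c v) = scaleW c (\<phi> v)) \<and>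
     (\<forall>x v. \<phi> (act x v) = act x (\<phi> v)) \<and> (\<forall>\<alpha>. \<forall>v\<in>D \<alpha>. \<phi> v \<in> D (\<alpha> + \<gamma>))}"

lemma homsI:
  assumes "\<And>v w. \<phi> (v + w) = \<phi> v + \<phi> w" "\<And>c v. \<phi> (scaleW c v) = scaleW c (\<phi> v)"
    "\<And>x v. \<phi> (act x v) = act x (\<phi> v)" "\<And>\<alpha> v. v \<in> D \<alpha> \<Longrightarrow> \<phi> v \<in> D (\<alpha> + \<gamma>)"
  shows "\<phi> \<in> homs \<gamma>"
  using assms by (simp add: homs_def)

lemma hom_add: "\<phi> \<in> homs \<gamma> \<Longrightarrow> \<phi> (v + w) = \<phi> v + \<phi> w"
  and hom_scale: "\<phi> \<in> homs \<gamma> \<Longrightarrow> \<phi> (scaleW c v) = scaleW c (\<phi> v)"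
  and hom_act: "\<phi> \<in> homs \<gamma> \<Longrightarrow> \<phi> (act x v) = act x (\<phi> v)"
  and hom_homogeneous: "\<phi> \<in> homs \<gamma> \<Longrightarrow> v \<in> D \<alpha> \<Longrightarrow> \<phi> v \<in> D (\<alpha> + \<gamma>)"
  by (simp_all add: homs_def)

lemma hom_0: "\<phi> \<in> homs \<gamma> \<Longrightarrow> \<phi> 0 = 0"
  using hom_add[of \<phi> \<gamma> 0 0] by simp

lemma hom_diff: "\<phi> \<in> homs \<gamma> \<Longrightarrow> \<phi> (v - w) = \<phi> v - \<phi> w"
  by (metis hom_add diff_add_cancel add_diff_cancel_right')

lemma component_hom:
  "\<phi> \<in> homs \<gamma> \<Longrightarrow> W.component (\<alpha> + \<gamma>) (\<phi> v) = \<phi> (W.component \<alpha> v)"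
  by (rule W.component_image_inj[of \<phi> "\<lambda>\<alpha>. \<alpha> + \<gamma>"])
    (auto intro: hom_add hom_homogeneous inj_onI)

lemma component_hom': "\<phi> \<in> homs \<gamma> \<Longrightarrow> W.component \<alpha> (\<phi> v) = \<phi> (W.component (\<alpha> - \<gamma>) v)"
  using component_hom[of \<phi> \<gamma> "\<alpha> - \<gamma>" v] by simp

lemma id_in_homs: "id \<in> homs 0"
  by (rule homsI) simp_all

lemma comp_in_homs: "\<phi> \<in> homs \<gamma> \<Longrightarrow> \<psi> \<in> homs \<delta> \<Longrightarrow> \<phi> \<circ> \<psi> \<in> homs (\<gamma> + \<delta>)"
  by (rule homsI)
    (simp_all add: hom_add hom_scale hom_act hom_homogeneous[of \<phi> \<gamma>] hom_homogeneous[of \<psi> \<delta>]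
      add.commute[of \<gamma>] flip: add.assoc)

lemma scale_in_homs: "\<phi> \<in> homs \<gamma> \<Longrightarrow> (\<lambda>v. scaleW c (\<phi> v)) \<in> homs \<gamma>"
  by (rule homsI)
    (simp_all add: hom_add hom_scale hom_act hom_homogeneous act_scale V.scale_right_distrib
      V.subspace_scale[OF W.subspace_D] mult.commute)

lemma diff_in_homs: "\<phi> \<in> homs \<gamma> \<Longrightarrow> \<psi> \<in> homs \<gamma> \<Longrightarrow> (\<lambda>v. \<phi> v - \<psi> v) \<in> homs \<gamma>"
proof (rule homsI)
  have act_diff: "act x (v - w) = act x v - act x w" for x v w
    by (metis act_add diff_add_cancel add_diff_cancel_right')
  show "\<phi> (act x v) - \<psi> (act x v) = act x (\<phi> v - \<psi> v)" if "\<phi> \<in> homs \<gamma>" "\<psi> \<in> homs \<gamma>" for x v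
    using that by (simp add: hom_act act_diff)
qed (simp_all add: hom_add hom_scale hom_homogeneous V.scale_right_diff_distrib
      V.subspace_diff[OF W.subspace_D])

text \<open>
  Kernel and image are graded submodules.
\<close>

lemma hom_bij:
  assumes \<phi>: "\<phi> \<in> homs \<gamma>" and nonzero: "\<phi> \<noteq> (\<lambda>_. 0)"
  shows "bij \<phi>"
proof (rule bijI)
  obtain w where w: "\<phi> w \<noteq> 0" using nonzero by auto
  have "{v. \<phi> v = 0} = {0} \<or> {v. \<phi> v = 0} = UNIV"
  proof (rule graded_subspace_trivial)
    show "V.subspace {v. \<phi> v = 0}"
      by (rule V.subspaceI) (simp_all add: hom_0[OF \<phi>] hom_add[OF \<phi>] hom_scale[OF \<phi>])
    show "act x u \<in> {v. \<phi> v = 0}" if "u \<in> {v. \<phi> v = 0}" for x u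
      using that act_add[of x 0 0] by (simp add: hom_act[OF \<phi>])
    show "W.component \<alpha> u \<in> {v. \<phi> v = 0}" if "u \<in> {v. \<phi> v = 0}" for \<alpha> u
      using that component_hom[OF \<phi>, of \<alpha> u] by simp
  qed
  then have kernel: "{v. \<phi> v = 0} = {0}" using w by auto
  show "inj \<phi>"
  proof (rule injI)
    fix v w assume "\<phi> v = \<phi> w"
    then have "v - w \<in> {v. \<phi> v = 0}" by (simp add: hom_diff[OF \<phi>])
    then show "v = w" unfolding kernel by simp
  qed
  have "range \<phi> = {0} \<or> range \<phi> = UNIV"
  proof (rule graded_subspace_trivial)
    show "V.subspace (range \<phi>)"
    proof (rule V.subspaceI)
      show "0 \<in> range \<phi>" by (metis hom_0[OF \<phi>] rangeI)
      show "x + y \<in> range \<phi>" if "x \<in> range \<phi>" "y \<in> range \<phi>" for x y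
        using that by (auto simp flip: hom_add[OF \<phi>])
      show "scaleW c x \<in> range \<phi>" if "x \<in> range \<phi>" for c x
        using that by (auto simp flip: hom_scale[OF \<phi>])
    qed
    show "act x u \<in> range \<phi>" if "u \<in> range \<phi>" for x u
      using that by (auto simp flip: hom_act[OF \<phi>])
    show "W.component \<alpha> u \<in> range \<phi>" if "u \<in> range \<phi>" for \<alpha> u
      using that by (auto simp: component_hom'[OF \<phi>])
  qed
  then show "surj \<phi>" using w by auto
qed

lemma inv_in_homs:
  assumes \<phi>: "\<phi> \<in> homs \<gamma>" and "bij \<phi>"
  shows "inv \<phi> \<in> homs (- \<gamma>)"
proof (rule homsI)
  note inv_simps = bij_is_surj[OF \<open>bij \<phi>\<close>, THEN surj_f_inv_f] bij_is_inj[OF \<open>bij \<phi>\<close>, THEN inv_f_f]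
  have inv_eqI: "inv \<phi> v = w" if "v = \<phi> w" for v w
    using that by (simp add: inv_simps)
  show "inv \<phi> (v + w) = inv \<phi> v + inv \<phi> w" for v w
    by (rule inv_eqI) (simp add: hom_add[OF \<phi>] inv_simps)
  show "inv \<phi> (scaleW c v) = scaleW c (inv \<phi> v)" for c v
    by (rule inv_eqI) (simp add: hom_scale[OF \<phi>] inv_simps)
  show "inv \<phi> (act x v) = act x (inv \<phi> v)" for x v
    by (rule inv_eqI) (simp add: hom_act[OF \<phi>] inv_simps)
  fix v \<alpha> assume "v \<in> D \<alpha>"
  have "inv \<phi> v = W.component (\<alpha> + - \<gamma>) (inv \<phi> v)"
  proof (rule inv_eqI)
    show "v = \<phi> (W.component (\<alpha> + - \<gamma>) (inv \<phi> v))"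
      using component_hom[OF \<phi>, of "\<alpha> + - \<gamma>" "inv \<phi> v"] \<open>v \<in> D \<alpha>\<close>
      by (simp add: inv_simps W.component_homogeneous)
  qed
  then show "inv \<phi> v \<in> D (\<alpha> + - \<gamma>)" by (metis W.component_in)
qed

lemma nonzero_exists: "\<exists>w :: 'w. w \<noteq> 0"
  using act_nontrivial by blast

end

locale small_graded_simple_module = graded_simple_module scaleG bracket G scaleW act D
  for scaleG :: "'k::alg_closed_field \<Rightarrow> 'g::ab_group_add \<Rightarrow> 'g"
    and bracket :: "'g \<Rightarrow> 'g \<Rightarrow> 'g"
    and G :: "'q::ab_group_add \<Rightarrow> 'g set"
    and scaleW :: "'k \<Rightarrow> 'w::ab_group_add \<Rightarrow> 'w"
    and act :: "'g \<Rightarrow> 'w \<Rightarrow> 'w"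
    and D :: "'q \<Rightarrow> 'w set" +
  assumes small_dim: "cardinal_dim scaleW <o |UNIV :: 'k set|"
begin

text \<open>
  Schur's lemma under the bound on the dimension: if \<open>\<phi>\<close> is not a scalar, then \<open>\<phi> - c\<close> is a nonzero
  homogeneous endomorphism, hence bijective, for every \<open>c\<close>.
\<close>

lemma hom_0_scalar:
  assumes \<phi>: "\<phi> \<in> homs 0"
  shows "\<exists>c. \<forall>v. \<phi> v = scaleW c v"
proof (rule ccontr)
  assume not_scalar: "\<not> ?thesis"
  obtain w :: 'w where "w \<noteq> 0" using nonzero_exists by blast
  have "|UNIV :: 'k set| \<le>o cardinal_dim scaleW"
  proof (rule UNIV_ordLeq_cardinal_dim_if_no_eigenvalue[of scaleW \<phi>])
    show "vector_space scaleW" by unfold_locales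
    show "\<phi> (v + w) = \<phi> v + \<phi> w" "\<phi> (scaleW c v) = scaleW c (\<phi> v)" for c v w
      using hom_add[OF \<phi>] hom_scale[OF \<phi>] .
    show "bij (\<lambda>v. \<phi> v - scaleW c v)" for c
    proof (rule hom_bij)
      show "(\<lambda>v. \<phi> v - scaleW c v) \<in> homs 0"
        using diff_in_homs[OF \<phi> scale_in_homs[OF id_in_homs, of c]] by simp
      show "(\<lambda>v. \<phi> v - scaleW c v) \<noteq> (\<lambda>_. 0)"
        using not_scalar by (auto simp: fun_eq_iff)
    qed
  qed fact
  with small_dim show False
    using not_ordLess_ordLeq by blast
qed

lemma homs_proportional:
  assumes "\<phi> \<in> homs \<gamma>" "\<psi> \<in> homs \<gamma>" "bij \<psi>"
  shows "\<exists>c. \<forall>v. \<phi> v = scaleW c (\<psi> v)"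
proof -
  have "\<phi> \<circ> inv \<psi> \<in> homs 0"
    using comp_in_homs[OF assms(1) inv_in_homs[OF assms(2,3)]] by simp
  then obtain c where "\<And>v. \<phi> (inv \<psi> v) = scaleW c v"
    using hom_0_scalar by fastforce
  then have "\<phi> v = scaleW c (\<psi> v)" for v
    using inv_f_f[OF bij_is_inj[OF assms(3)]] by metis
  then show ?thesis by blast
qed

end

section \<open>Commuting homogeneous automorphisms\<close>

context small_graded_simple_module
begin

text \<open>
  A commuting family maps injectively to the homogeneous automorphisms modulo scalars. By
  \<open>homs_proportional\<close> this amounts to having at most one element in each degree
  (\<open>family_hom_eq\<close>). Proportionality keeps the treatment of powers of a further
  automorphism free of calculations with multiples of degrees.
\<close>

definition commuting_families :: "('w \<Rightarrow> 'w) set set" where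
  "commuting_families = {M. (\<forall>u\<in>M. bij u \<and> (\<exists>\<gamma>. u \<in> homs \<gamma>)) \<and> id \<in> M \<and>
     (\<forall>u\<in>M. \<forall>v\<in>M. u \<circ> v \<in> M \<and> u \<circ> v = v \<circ> u) \<and>
     (\<forall>u\<in>M. \<forall>v\<in>M. \<forall>c. (\<forall>w. u w = scaleW c (v w)) \<longrightarrow> u = v)}"

lemma hom_funpow:
  assumes "\<phi> \<in> homs \<gamma>"
  shows "\<exists>\<delta>. \<phi> ^^ n \<in> homs \<delta>"
proof (induction n)
  case 0
  then show ?case using id_in_homs by (auto simp: id_def)
next
  case (Suc n)
  then show ?case using comp_in_homs[OF assms] by (auto simp: comp_def)
qed

lemma maximal_family_exists:
  "\<exists>M\<in>commuting_families. \<forall>X\<in>commuting_families. M \<subseteq> X \<longrightarrow> X = M"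
proof (rule subset_Zorn_nonempty)
  have "c = 1" if "\<forall>w::'w. w = scaleW c w" for c
  proof -
    obtain w :: 'w where "w \<noteq> 0" using nonzero_exists by blast
    then show ?thesis using that by (metis V.scale_cancel_right V.scale_one)
  qed
  then have "{id} \<in> commuting_families"
    using id_in_homs by (auto simp: commuting_families_def)
  then show "commuting_families \<noteq> {}" by blast
next
  fix C assume C: "C \<noteq> {}" "subset.chain commuting_families C"
  have family: "X \<in> commuting_families" if "X \<in> C" for X
    using C(2) that by (auto simp: subset.chain_def)
  have common: "\<exists>X\<in>C. u \<in> X \<and> v \<in> X" if uv: "u \<in> \<Union> C" "v \<in> \<Union> C" for u v
  proof -
    obtain X Y where "X \<in> C" "Y \<in> C" "u \<in> X" "v \<in> Y" using uv by blast
    moreover have "X \<subseteq> Y \<or> Y \<subseteq> X"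
      using C(2) calculation by (auto simp: subset_chain_def)
    ultimately show ?thesis by blast
  qed
  show "\<Union> C \<in> commuting_families"
    unfolding commuting_families_def
  proof (intro CollectI conjI ballI allI impI)
    show "bij u" "\<exists>\<gamma>. u \<in> homs \<gamma>" if "u \<in> \<Union> C" for u
      using that family by (auto simp: commuting_families_def)
    show "id \<in> \<Union> C"
      using C(1) family by (auto simp: commuting_families_def)
  next
    fix u v assume "u \<in> \<Union> C" "v \<in> \<Union> C"
    then obtain X where X: "X \<in> C" "u \<in> X" "v \<in> X" using common by blast
    then show "u \<circ> v \<in> \<Union> C" "u \<circ> v = v \<circ> u"
      using family[OF X(1)] by (auto simp: commuting_families_def)
    show "u = v" if "\<forall>w. u w = scaleW c (v w)" for c
      using X that family[OF X(1)] unfolding commuting_families_def by blast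
  qed
qed

context
  fixes M :: "('w \<Rightarrow> 'w) set"
  assumes M: "M \<in> commuting_families"
begin

lemma family_bij: "u \<in> M \<Longrightarrow> bij u"
  and family_hom: "u \<in> M \<Longrightarrow> \<exists>\<gamma>. u \<in> homs \<gamma>"
  and id_in_family: "id \<in> M"
  and comp_in_family: "u \<in> M \<Longrightarrow> v \<in> M \<Longrightarrow> u \<circ> v \<in> M"
  and family_eqI: "u \<in> M \<Longrightarrow> v \<in> M \<Longrightarrow> (\<And>w. u w = scaleW c (v w)) \<Longrightarrow> u = v"
  using M unfolding commuting_families_def by blast+

lemma family_commute: "u \<in> M \<Longrightarrow> v \<in> M \<Longrightarrow> u (v w) = v (u w)"
  using M by (simp add: commuting_families_def fun_eq_iff)

lemma family_scale: "u \<in> M \<Longrightarrow> u (scaleW c v) = scaleW c (u v)"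
  using family_hom hom_scale by blast

lemma funpow_in_family: "u \<in> M \<Longrightarrow> u ^^ n \<in> M"
  by (induction n) (auto simp: id_in_family comp_in_family simp flip: id_def)

lemma family_hom_eq:
  assumes "u \<in> M" "v \<in> M" "u \<in> homs \<gamma>" "v \<in> homs \<gamma>"
  shows "u = v"
  using homs_proportional[OF assms(3,4) family_bij[OF assms(2)]] family_eqI[OF assms(1,2)] by blast

text \<open>
  The assumption \<open>rigid\<close> excludes new multiples of elements of \<open>M\<close> among the products \<open>u \<circ> \<psi>\<^sup>j\<close>. It
  suffices for all pairs of products, because in a proportionality between two of them the smaller
  power of \<open>\<psi>\<close> cancels.
\<close>

lemma adjoin_in_commuting_families:
  assumes \<psi>: "\<psi> \<in> homs \<gamma>" "bij \<psi>" and commute: "\<And>u w. u \<in> M \<Longrightarrow> u (\<psi> w) = \<psi> (u w)"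
    and rigid: "\<And>j u v c w. u \<in> M \<Longrightarrow> v \<in> M \<Longrightarrow> (\<And>w. u ((\<psi> ^^ j) w) = scaleW c (v w)) \<Longrightarrow>
      u ((\<psi> ^^ j) w) = v w"
  shows "{u \<circ> \<psi> ^^ n | u n. u \<in> M} \<in> commuting_families"
proof -
  have pow_commute: "u ((\<psi> ^^ n) w) = (\<psi> ^^ n) (u w)" if "u \<in> M" for u n w
    by (induction n arbitrary: w) (simp_all add: commute[OF that])
  have pow_pow: "(\<psi> ^^ m) ((\<psi> ^^ n) w) = (\<psi> ^^ (m + n)) w" for m n w
    by (simp add: funpow_add)
  have bij_pow: "bij (\<psi> ^^ n)" for n
    using \<psi>(2) by (rule bij_betw_funpow)
  have cancel: "u \<circ> \<psi> ^^ m = v \<circ> \<psi> ^^ n"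
    if "n \<le> m" "u \<in> M" "v \<in> M" "\<And>w. u ((\<psi> ^^ m) w) = scaleW c (v ((\<psi> ^^ n) w))" for u v m n c
  proof -
    have "u ((\<psi> ^^ (m - n)) y) = v y" for y
    proof (rule rigid[of u v "m - n" c])
      fix y
      obtain w where y: "y = (\<psi> ^^ n) w"
        using bij_is_surj[OF bij_pow] by (rule surjE)
      show "u ((\<psi> ^^ (m - n)) y) = scaleW c (v y)"
        using that unfolding y by (simp add: pow_pow)
    qed fact+
    from this[of "(\<psi> ^^ n) _"] show ?thesis
      using that(1) by (auto simp: fun_eq_iff pow_pow)
  qed
  define X where "X = {u \<circ> \<psi> ^^ n | u n. u \<in> M}"
  have X: "u \<circ> \<psi> ^^ n \<in> X" if "u \<in> M" for u n
    using that by (auto simp: X_def)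
  have "X \<in> commuting_families"
    unfolding commuting_families_def
  proof (intro CollectI conjI ballI allI impI)
    show "bij u" if "u \<in> X" for u
      using that unfolding X_def using bij_pow family_bij by (auto intro: bij_comp)
    show "\<exists>\<gamma>. u \<in> homs \<gamma>" if "u \<in> X" for u
      using that unfolding X_def using hom_funpow[OF \<psi>(1)] family_hom comp_in_homs by blast
    show "id \<in> X" using X[OF id_in_family, of 0] by (simp add: id_def comp_def)
    fix u v assume "u \<in> X" "v \<in> X"
    then obtain u' m v' n where uv: "u = u' \<circ> \<psi> ^^ m" "v = v' \<circ> \<psi> ^^ n" "u' \<in> M" "v' \<in> M"
      unfolding X_def by blast
    have "u \<circ> v = (u' \<circ> v') \<circ> \<psi> ^^ (m + n)"
      by (auto simp: uv fun_eq_iff pow_commute[OF uv(4)] simp flip: pow_pow)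
    then show "u \<circ> v \<in> X" using X[OF comp_in_family[OF uv(3,4)]] by simp
    show "u \<circ> v = v \<circ> u"
      by (auto simp: uv fun_eq_iff pow_commute pow_pow family_commute[OF uv(3,4)] add.commute)
    fix c assume c: "\<forall>w. u w = scaleW c (v w)"
    show "u = v"
    proof (cases "n \<le> m")
      case True
      then show ?thesis using cancel[of n m u' v' c] c by (simp add: uv)
    next
      case False
      obtain w :: 'w where "w \<noteq> 0" using nonzero_exists by blast
      obtain w' where "u w' = w"
        using bij_is_surj[OF bij_comp[OF bij_pow family_bij[OF uv(3)]]] uv(1) by (metis surjE)
      then have "c \<noteq> 0" using c \<open>w \<noteq> 0\<close> by auto
      then have "v w = scaleW (1 / c) (u w)" for w using c by simp
      then show ?thesis using False cancel[of m n v' u' "1 / c"] by (simp add: uv)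
    qed
  qed
  then show ?thesis by (simp add: X_def)
qed

text \<open>
  Call \<open>j\<close> related if \<open>\<phi>\<^sup>j\<close> is a multiple of a quotient of two elements of \<open>M\<close>. The related numbers are
  closed under differences, so they are multiples of the least positive one, \<open>k\<close>. A \<open>k\<close>-th root of a
  scalar rescales \<open>\<phi>\<close> so that its \<open>k\<close>-th power is exactly a quotient of elements of \<open>M\<close>; then so
  are the \<open>qk\<close>-th powers. If no positive number is related, \<open>\<phi>\<close> itself will do.
\<close>

lemma rigid_multiple_exists:
  assumes \<phi>: "\<phi> \<in> homs \<gamma>" "bij \<phi>" and commute: "\<And>u w. u \<in> M \<Longrightarrow> u (\<phi> w) = \<phi> (u w)"
  obtains a where "a \<noteq> 0"
    "\<And>j u v c w. u \<in> M \<Longrightarrow> v \<in> M \<Longrightarrow> (\<And>w. u (((\<lambda>w. scaleW a (\<phi> w)) ^^ j) w) = scaleW c (v w)) \<Longrightarrow>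
      u (((\<lambda>w. scaleW a (\<phi> w)) ^^ j) w) = v w"
proof -
  have pow_commute: "u ((\<phi> ^^ n) w) = (\<phi> ^^ n) (u w)" if "u \<in> M" for u n w
    by (induction n arbitrary: w) (simp_all add: commute[OF that])
  have nonzero: "c \<noteq> 0" if u: "u \<in> M" and uv: "\<And>w. u ((\<phi> ^^ j) w) = scaleW c (v w)" for u v j c
  proof -
    obtain w :: 'w where "w \<noteq> 0" using nonzero_exists by blast
    moreover obtain w' where "(u \<circ> \<phi> ^^ j) w' = w"
      using bij_is_surj[OF bij_comp[OF bij_betw_funpow[OF \<phi>(2)] family_bij[OF u]]] by (metis surjE)
    ultimately show ?thesis using uv[of w'] by auto
  qed
  have pow_multiple: "((\<lambda>w. scaleW a (\<phi> w)) ^^ j) w = scaleW (a ^ j) ((\<phi> ^^ j) w)" for a j w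
    by (induction j) (simp_all add: hom_scale[OF \<phi>(1)] mult.commute)
  define related where "related j \<longleftrightarrow> (\<exists>u\<in>M. \<exists>v\<in>M. \<exists>c. \<forall>w. u ((\<phi> ^^ j) w) = scaleW c (v w))" for j
  have related_diff: "related (j - i)" if "i \<le> j" "related i" "related j" for i j
  proof -
    obtain u v c where uv: "u \<in> M" "v \<in> M" "\<And>w. u ((\<phi> ^^ i) w) = scaleW c (v w)"
      using \<open>related i\<close> by (auto simp: related_def)
    obtain u' v' c' where uv': "u' \<in> M" "v' \<in> M" "\<And>w. u' ((\<phi> ^^ j) w) = scaleW c' (v' w)"
      using \<open>related j\<close> by (auto simp: related_def)
    have "(u' \<circ> v) ((\<phi> ^^ (j - i)) w) = scaleW (c' / c) ((u \<circ> v') w)" for w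
    proof -
      let ?y = "(\<phi> ^^ (j - i)) w"
      have y: "(\<phi> ^^ i) ?y = (\<phi> ^^ j) w"
        using \<open>i \<le> j\<close> funpow_add[of i "j - i" \<phi>] by simp
      have "scaleW c (u' (v ?y)) = u' (u ((\<phi> ^^ i) ?y))"
        by (simp add: uv(3) family_scale[OF uv'(1)])
      also have "\<dots> = u (u' ((\<phi> ^^ j) w))"
        by (simp only: y family_commute[OF uv(1) uv'(1)])
      also have "\<dots> = scaleW c' (u (v' w))"
        by (simp add: uv'(3) family_scale[OF uv(1)])
      finally have "scaleW (1 / c) (scaleW c (u' (v ?y))) = scaleW (1 / c) (scaleW c' (u (v' w)))"
        by simp
      then show ?thesis using nonzero[OF uv(1,3)] by simp
    qed
    then show ?thesis
      using comp_in_family uv(1,2) uv'(1,2) unfolding related_def by blast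
  qed
  show thesis
  proof (cases "\<exists>k>0. related k")
    case False
    show thesis
    proof (rule that[of 1])
      fix j u v c w
      assume u: "u \<in> M" and v: "v \<in> M"
        and uv: "\<And>w. u (((\<lambda>w. scaleW 1 (\<phi> w)) ^^ j) w) = scaleW c (v w)"
      have "\<forall>w. u ((\<phi> ^^ j) w) = scaleW c (v w)"
        using uv unfolding pow_multiple by simp
      then have "related j" using u v unfolding related_def by blast
      then have j: "j = 0" using False by (metis gr0I)
      have "u = v"
      proof (rule family_eqI[OF u v])
        show "u w = scaleW c (v w)" for w using uv[of w] unfolding j by simp
      qed
      then show "u (((\<lambda>w. scaleW 1 (\<phi> w)) ^^ j) w) = v w"
        unfolding j by simp
    qed simp
  next
    case True
    define k where "k = (LEAST k. 0 < k \<and> related k)"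
    have k: "0 < k" "related k"
      using LeastI_ex[of "\<lambda>k. 0 < k \<and> related k"] True by (auto simp: k_def)
    have k_dvd: "k dvd j" if "related j" for j
      using that
    proof (induction j rule: less_induct)
      case (less j)
      show ?case
      proof (cases "j = 0")
        case False
        then have "k \<le> j" unfolding k_def using less.prems by (intro Least_le) simp
        then have "k dvd j - k"
          using False k less related_diff by simp
        then show ?thesis using dvd_diffD[OF _ dvd_refl \<open>k \<le> j\<close>] by simp
      qed simp
    qed
    obtain u0 v0 c0 where uv0: "u0 \<in> M" "v0 \<in> M" "\<And>w. u0 ((\<phi> ^^ k) w) = scaleW c0 (v0 w)"
      using k(2) unfolding related_def by blast
    have c0: "c0 \<noteq> 0" by (rule nonzero[OF uv0(1,3)])
    obtain a where a: "a ^ k = 1 / c0" using nth_root_exists[OF k(1)] by blast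
    then have "a \<noteq> 0" using c0 k(1) by (auto simp: power_0_left)
    let ?\<psi> = "\<lambda>w. scaleW a (\<phi> w)"
    have psi_commute: "u ((?\<psi> ^^ n) w) = (?\<psi> ^^ n) (u w)" if "u \<in> M" for u n w
      using pow_commute[OF that] by (simp add: pow_multiple family_scale[OF that])
    have base: "u0 ((?\<psi> ^^ k) w) = v0 w" for w
      using c0 by (simp add: pow_multiple family_scale[OF uv0(1)] uv0(3) a)
    \<comment> \<open>The \<open>q\<close>-th powers of both sides of \<open>base\<close>; all maps involved commute.\<close>
    have multiple: "(u0 ^^ q) ((?\<psi> ^^ (q * k)) w) = (v0 ^^ q) w" for q w
    proof (induction q arbitrary: w)
      case (Suc q)
      have "(u0 ^^ Suc q) ((?\<psi> ^^ (Suc q * k)) w) = u0 ((u0 ^^ q) ((?\<psi> ^^ (q * k)) ((?\<psi> ^^ k) w)))"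
        by (simp add: add.commute[of k] funpow_add)
      also have "\<dots> = (v0 ^^ q) (u0 ((?\<psi> ^^ k) w))"
        by (simp only: Suc family_commute[OF uv0(1) funpow_in_family[OF uv0(2)]])
      also have "\<dots> = (v0 ^^ Suc q) w"
        by (simp only: base funpow_Suc_right comp_def)
      finally show ?case .
    qed simp
    show thesis
    proof (rule that[OF \<open>a \<noteq> 0\<close>])
      fix j u v c w
      assume u: "u \<in> M" and v: "v \<in> M" and uv: "\<And>w. u ((?\<psi> ^^ j) w) = scaleW c (v w)"
      have "u ((\<phi> ^^ j) w) = scaleW (c / a ^ j) (v w)" for w
      proof -
        have "scaleW (1 / a ^ j) (scaleW (a ^ j) (u ((\<phi> ^^ j) w))) = scaleW (1 / a ^ j) (scaleW c (v w))"
          using uv[of w] by (simp only: pow_multiple family_scale[OF u])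
        then show ?thesis using \<open>a \<noteq> 0\<close> by simp
      qed
      then have "related j" using u v unfolding related_def by blast
      then obtain q where q: "j = q * k" using k_dvd by (metis dvd_div_mult_self)
      have u0_q: "u0 ^^ q \<in> M" and v0_q: "v0 ^^ q \<in> M"
        using uv0 by (auto intro: funpow_in_family)
      have shift: "u ((?\<psi> ^^ j) ((u0 ^^ q) y)) = u ((v0 ^^ q) y)" for y
        using multiple[of q y] psi_commute[OF u0_q] by (simp add: q)
      \<comment> \<open>Both sides are in \<open>M\<close> and proportional with factor \<open>c\<close>, so they coincide.\<close>
      have "u \<circ> v0 ^^ q = v \<circ> u0 ^^ q"
        using uv shift
        by (intro family_eqI[where c = c] comp_in_family u v u0_q v0_q) (simp flip: shift)
      moreover obtain y where "w = (u0 ^^ q) y"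
        using bij_is_surj[OF family_bij[OF u0_q]] by (rule surjE)
      ultimately show "u ((?\<psi> ^^ j) w) = v w"
        using shift by (simp add: fun_eq_iff)
    qed
  qed
qed

end

text \<open>
  Adjoining a suitable multiple of \<open>\<phi>\<close> to \<open>M\<close> gives a commuting family, which cannot be larger than \<open>M\<close>.
\<close>

lemma maximal_family_absorbs:
  assumes M: "M \<in> commuting_families" and max: "\<And>X. X \<in> commuting_families \<Longrightarrow> M \<subseteq> X \<Longrightarrow> X = M"
    and \<phi>: "\<phi> \<in> homs \<gamma>" "bij \<phi>" and commute: "\<And>u w. u \<in> M \<Longrightarrow> u (\<phi> w) = \<phi> (u w)"
  shows "\<exists>a. (\<lambda>w. scaleW a (\<phi> w)) \<in> M"
proof -
  obtain a where a: "a \<noteq> 0"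
    "\<And>j u v c w. u \<in> M \<Longrightarrow> v \<in> M \<Longrightarrow> (\<And>w. u (((\<lambda>w. scaleW a (\<phi> w)) ^^ j) w) = scaleW c (v w)) \<Longrightarrow>
      u (((\<lambda>w. scaleW a (\<phi> w)) ^^ j) w) = v w"
    using rigid_multiple_exists[OF M \<phi> commute] by blast
  let ?\<psi> = "\<lambda>w. scaleW a (\<phi> w)"
  let ?X = "{u \<circ> ?\<psi> ^^ n | u n. u \<in> M}"
  have \<psi>: "?\<psi> \<in> homs \<gamma>" by (rule scale_in_homs[OF \<phi>(1)])
  have "?X \<in> commuting_families"
  proof (rule adjoin_in_commuting_families[OF M \<psi>])
    obtain w :: 'w where "w \<noteq> 0" using nonzero_exists by blast
    obtain w' where "\<phi> w' = w" using bij_is_surj[OF \<phi>(2)] by (metis surjE)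
    then have "?\<psi> \<noteq> (\<lambda>_. 0)" using \<open>w \<noteq> 0\<close> a(1) by (auto simp: fun_eq_iff)
    then show "bij ?\<psi>" by (rule hom_bij[OF \<psi>])
    show "u (?\<psi> w) = ?\<psi> (u w)" if "u \<in> M" for u w
      by (simp add: family_scale[OF M that] commute[OF that])
    show "u ((?\<psi> ^^ j) w) = v w"
      if "u \<in> M" "v \<in> M" "\<And>w. u ((?\<psi> ^^ j) w) = scaleW c (v w)" for j u v c w
      by (rule a(2)[OF that])
  qed
  moreover have "M \<subseteq> ?X"
  proof
    fix u assume "u \<in> M"
    moreover have "u = u \<circ> ?\<psi> ^^ 0" by (simp add: fun_eq_iff)
    ultimately show "u \<in> ?X" by blast
  qed
  ultimately have "?X = M" by (rule max)
  moreover have "?\<psi> = id \<circ> ?\<psi> ^^ 1" by (simp add: fun_eq_iff)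
  ultimately show ?thesis using id_in_family[OF M] by blast
qed

end

section \<open>Identifying components along a maximal commuting family\<close>

lemma coset_eq_iff:
  assumes "is_subgroup P"
  shows "\<alpha> +o P = \<beta> +o P \<longleftrightarrow> \<alpha> - \<beta> \<in> P"
proof
  assume "\<alpha> +o P = \<beta> +o P"
  moreover have "\<alpha> \<in> \<alpha> +o P"
    using assms by (force simp: is_subgroup_def elt_set_plus_def)
  ultimately show "\<alpha> - \<beta> \<in> P" by (auto simp: elt_set_plus_def)
next
  have sub: "\<alpha> +o P \<subseteq> \<beta> +o P" if "\<alpha> - \<beta> \<in> P" for \<alpha> \<beta>
  proof
    fix x assume "x \<in> \<alpha> +o P"
    then obtain p where "p \<in> P" "x = \<alpha> + p" by (auto simp: elt_set_plus_def)
    then have "x = \<beta> + ((\<alpha> - \<beta>) + p)" "(\<alpha> - \<beta>) + p \<in> P"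
      using assms that by (auto simp: is_subgroup_def)
    then show "x \<in> \<beta> +o P" unfolding elt_set_plus_def by blast
  qed
  assume "\<alpha> - \<beta> \<in> P"
  moreover have "\<beta> - \<alpha> \<in> P"
    using assms calculation unfolding is_subgroup_def by (metis minus_diff_eq)
  ultimately show "\<alpha> +o P = \<beta> +o P" using sub by blast
qed

lemma coset_add:
  assumes "is_subgroup P"
  shows "(\<alpha> +o P) + (\<beta> +o P) = (\<alpha> + \<beta>) +o P"
proof -
  have "P + P = P"
    using assms by (force simp: is_subgroup_def set_plus_def)
  then show ?thesis by (simp add: set_plus_rearrange)
qed

locale maximal_commuting_family = small_graded_simple_module scaleG bracket G scaleW act D
  for scaleG :: "'k::alg_closed_field \<Rightarrow> 'g::ab_group_add \<Rightarrow> 'g"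
    and bracket :: "'g \<Rightarrow> 'g \<Rightarrow> 'g"
    and G :: "'q::ab_group_add \<Rightarrow> 'g set"
    and scaleW :: "'k \<Rightarrow> 'w::ab_group_add \<Rightarrow> 'w"
    and act :: "'g \<Rightarrow> 'w \<Rightarrow> 'w"
    and D :: "'q \<Rightarrow> 'w set" +
  fixes M :: "('w \<Rightarrow> 'w) set"
  assumes family: "M \<in> commuting_families"
    and maximal: "X \<in> commuting_families \<Longrightarrow> M \<subseteq> X \<Longrightarrow> X = M"
begin

lemmas M_bij = family_bij[OF family]
  and M_hom = family_hom[OF family]
  and M_id = id_in_family[OF family]
  and M_comp = comp_in_family[OF family]
  and M_eqI = family_eqI[OF family]
  and M_commute = family_commute[OF family]
  and M_scale = family_scale[OF family]
  and M_hom_eq = family_hom_eq[OF family]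
  and M_absorbs = maximal_family_absorbs[OF family maximal]

lemma M_add: "u \<in> M \<Longrightarrow> u (v + w) = u v + u w"
  using M_hom hom_add by blast

lemma M_act: "u \<in> M \<Longrightarrow> u (act x v) = act x (u v)"
  using M_hom hom_act by blast

lemma M_0: "u \<in> M \<Longrightarrow> u 0 = 0"
  using M_hom hom_0 by blast

lemma M_inj: "u \<in> M \<Longrightarrow> u v = u w \<longleftrightarrow> v = w"
  using M_bij bij_is_inj inj_eq by metis

lemma M_surj: "u \<in> M \<Longrightarrow> u (inv u v) = v"
  by (simp add: M_bij bij_is_surj surj_f_inv_f)

text \<open>
  A multiple of the inverse of \<open>u\<close> is in \<open>M\<close>. Its product with \<open>u\<close> is a scalar in \<open>M\<close>, hence the
  identity, as \<open>M\<close> contains no other multiple of the identity.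
\<close>

lemma M_inv:
  assumes u: "u \<in> M"
  shows "inv u \<in> M"
proof -
  obtain \<gamma> where \<gamma>: "u \<in> homs \<gamma>" using M_hom[OF u] by blast
  obtain a where a: "(\<lambda>w. scaleW a (inv u w)) \<in> M"
    using M_absorbs[OF _ _ inv_in_homs[OF \<gamma> M_bij[OF u]] bij_imp_bij_inv[OF M_bij[OF u]]]
      M_commute[OF _ u] M_inj[OF u] M_surj[OF u] by metis
  have "u \<circ> (\<lambda>w. scaleW a (inv u w)) = id"
    by (rule M_eqI[OF M_comp[OF u a] M_id, of a]) (simp add: M_scale[OF u] M_surj[OF u])
  then have "scaleW a (inv u w) = inv u w" for w
    using M_inj[OF u, of "scaleW a (inv u w)" "inv u w"] by (simp add: M_surj[OF u] fun_eq_iff)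
  then show ?thesis using a by simp
qed

definition degrees :: "'q set" where
  "degrees = {\<gamma>. \<exists>u\<in>M. u \<in> homs \<gamma>}"

lemma subgroup_degrees: "is_subgroup degrees"
  unfolding is_subgroup_def
proof (intro conjI ballI)
  show "0 \<in> degrees" using M_id id_in_homs by (auto simp: degrees_def)
  show "a + b \<in> degrees" if "a \<in> degrees" "b \<in> degrees" for a b
    using that M_comp comp_in_homs unfolding degrees_def by blast
  show "- a \<in> degrees" if "a \<in> degrees" for a
    using that M_inv inv_in_homs M_bij unfolding degrees_def by blast
qed

text \<open>
  The maximality of \<open>M\<close> in the form in which the proof of simplicity uses it.
\<close>

lemma degree_of_commuting_hom:
  assumes \<phi>: "\<phi> \<in> homs \<gamma>" "\<phi> \<noteq> (\<lambda>_. 0)" and commute: "\<And>u w. u \<in> M \<Longrightarrow> u (\<phi> w) = \<phi> (u w)"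
  shows "\<gamma> \<in> degrees"
proof -
  obtain a where "(\<lambda>w. scaleW a (\<phi> w)) \<in> M"
    using M_absorbs[OF _ _ \<phi>(1) hom_bij[OF \<phi>] commute] by blast
  then show ?thesis using scale_in_homs[OF \<phi>(1)] by (auto simp: degrees_def)
qed

definition coset_rep :: "'q set \<Rightarrow> 'q" where
  "coset_rep A = (SOME \<alpha>. \<alpha> \<in> A)"

definition deg_rep :: "'q \<Rightarrow> 'q" where
  "deg_rep \<alpha> = coset_rep (\<alpha> +o degrees)"

lemma deg_rep_diff: "deg_rep \<alpha> - \<alpha> \<in> degrees"
proof -
  have "\<alpha> \<in> \<alpha> +o degrees"
    using subgroup_degrees by (force simp: is_subgroup_def elt_set_plus_def)
  then have "deg_rep \<alpha> \<in> \<alpha> +o degrees"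
    unfolding deg_rep_def coset_rep_def by (rule someI)
  then show ?thesis by (auto simp: elt_set_plus_def)
qed

lemma deg_rep_coset: "deg_rep \<alpha> +o degrees = \<alpha> +o degrees"
  by (simp add: coset_eq_iff[OF subgroup_degrees] deg_rep_diff)

lemma deg_rep_eq_iff: "deg_rep \<alpha> = deg_rep \<beta> \<longleftrightarrow> \<alpha> - \<beta> \<in> degrees"
  by (metis coset_eq_iff[OF subgroup_degrees] deg_rep_coset deg_rep_def)

lemma deg_rep_tr: "deg_rep (deg_rep \<alpha>) = deg_rep \<alpha>"
  by (simp add: deg_rep_eq_iff deg_rep_diff)

text \<open>
  The element of \<open>M\<close> that carries the component of degree \<open>\<alpha>\<close> to the component of the chosen degree of
  its coset.
\<close>

definition \<theta> :: "'q \<Rightarrow> 'w \<Rightarrow> 'w" where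
  "\<theta> \<alpha> = (SOME u. u \<in> M \<and> u \<in> homs (deg_rep \<alpha> - \<alpha>))"

lemma theta: "\<theta> \<alpha> \<in> M" "\<theta> \<alpha> \<in> homs (deg_rep \<alpha> - \<alpha>)"
proof -
  have "\<exists>u. u \<in> M \<and> u \<in> homs (deg_rep \<alpha> - \<alpha>)"
    using deg_rep_diff by (auto simp: degrees_def)
  from someI_ex[OF this] show "\<theta> \<alpha> \<in> M" "\<theta> \<alpha> \<in> homs (deg_rep \<alpha> - \<alpha>)"
    by (simp_all add: \<theta>_def)
qed

text \<open>
  The projection onto the sum of the components of chosen degrees, with kernel spanned by
  the \<open>u w - w\<close> for \<open>u \<in> M\<close>.
\<close>

definition \<pi> :: "'w \<Rightarrow> 'w" where
  "\<pi> = W.glue \<theta>"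

lemma pi_add: "\<pi> (v + w) = \<pi> v + \<pi> w"
  unfolding \<pi>_def by (rule W.glue_add) (rule M_add[OF theta(1)])

lemma pi_0 [simp]: "\<pi> 0 = 0"
  using pi_add[of 0 0] by simp

lemma pi_diff: "\<pi> (v - w) = \<pi> v - \<pi> w"
  by (metis pi_add diff_add_cancel add_diff_cancel_right')

lemma pi_homogeneous: "v \<in> D \<alpha> \<Longrightarrow> \<pi> v = \<theta> \<alpha> v"
  unfolding \<pi>_def by (rule W.glue_homogeneous) (simp_all add: M_0 theta)

lemma pi_scale: "\<pi> (scaleW c v) = scaleW c (\<pi> v)"
proof (induction v rule: W.homogeneous_induct)
  case (homogeneous \<alpha> v)
  then show ?case
    using pi_homogeneous[OF V.subspace_scale[OF W.subspace_D homogeneous]]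
    by (simp add: pi_homogeneous[OF homogeneous] M_scale theta)
qed (simp add: pi_add V.scale_right_distrib)

lemma pi_degree: "v \<in> D \<alpha> \<Longrightarrow> \<pi> v \<in> D (deg_rep \<alpha>)"
  using hom_homogeneous[OF theta(2)[of \<alpha>], of v \<alpha>] by (simp add: pi_homogeneous)

lemma pi_eq_0: "v \<in> D \<alpha> \<Longrightarrow> \<pi> v = 0 \<longleftrightarrow> v = 0"
  using M_inj[OF theta(1)[of \<alpha>], of v 0] by (simp add: pi_homogeneous M_0 theta)

text \<open>
  Elements of \<open>M\<close> are determined by their degrees, so carrying \<open>v\<close> to the chosen degree directly or
  after applying \<open>u\<close> gives the same result.
\<close>

lemma pi_M:
  assumes u: "u \<in> M"
  shows "\<pi> (u v) = \<pi> v"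
proof (induction v rule: W.homogeneous_induct)
  case (homogeneous \<alpha> v)
  obtain \<gamma> where \<gamma>: "u \<in> homs \<gamma>" using M_hom[OF u] by blast
  then have deg_rep: "deg_rep (\<alpha> + \<gamma>) = deg_rep \<alpha>" using u by (auto simp: deg_rep_eq_iff degrees_def)
  have "\<theta> (\<alpha> + \<gamma>) \<circ> u = \<theta> \<alpha>"
  proof (rule M_hom_eq[OF M_comp[OF theta(1) u] theta(1)])
    show "\<theta> (\<alpha> + \<gamma>) \<circ> u \<in> homs (deg_rep \<alpha> - \<alpha>)"
      using comp_in_homs[OF theta(2)[of "\<alpha> + \<gamma>"] \<gamma>] by (simp add: deg_rep algebra_simps)
  qed (rule theta)
  then show ?case
    using pi_homogeneous[OF hom_homogeneous[OF \<gamma> homogeneous]] pi_homogeneous[OF homogeneous]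
    by (simp add: fun_eq_iff)
qed (simp add: M_add[OF u] pi_add)

lemma pi_pi: "\<pi> (\<pi> v) = \<pi> v"
  by (induction v rule: W.homogeneous_induct)
    (simp_all add: pi_add pi_homogeneous pi_M theta flip: pi_homogeneous[of "\<theta> _ _"])

text \<open>
  On each component \<open>\<pi>\<close> is an element of \<open>M\<close>, which commutes with the Lie algebra, so this is
  \<open>pi_M\<close>. It says that the kernel of \<open>\<pi>\<close> is a submodule, and it makes \<open>\<pi> (act x v)\<close>
  an action on the image.
\<close>

lemma pi_act_pi: "\<pi> (act x (\<pi> v)) = \<pi> (act x v)"
proof (induction v rule: W.homogeneous_induct)
  case (homogeneous \<alpha> v)
  then show ?case by (simp add: pi_homogeneous[OF homogeneous] theta pi_M flip: M_act)
qed (simp add: pi_add act_add)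

lemma pi_fixed: "v \<in> D (deg_rep \<alpha>) \<Longrightarrow> \<pi> v = v"
proof -
  have "\<theta> (deg_rep \<alpha>) = id"
    using M_hom_eq[OF theta(1) M_id theta(2)[of "deg_rep \<alpha>"]] id_in_homs by (simp add: deg_rep_tr)
  then show "v \<in> D (deg_rep \<alpha>) \<Longrightarrow> \<pi> v = v" by (simp add: pi_homogeneous)
qed


text \<open>
  The quotient of \<open>W\<close> by the kernel of \<open>\<pi>\<close>, realised as the image of \<open>\<pi>\<close>, with the induced action and
  grading.
\<close>

definition carrier :: "'w set" where
  "carrier = {v. \<pi> v = v}"

definition action :: "'g \<Rightarrow> 'w \<Rightarrow> 'w" where
  "action x v = \<pi> (act x v)"

definition grading :: "'q set \<Rightarrow> 'w set" where
  "grading A = carrier \<inter> D (coset_rep A)"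

lemma carrier_iff: "v \<in> carrier \<longleftrightarrow> \<pi> v = v"
  by (simp add: carrier_def)

lemma pi_in_carrier: "\<pi> v \<in> carrier"
  by (simp add: carrier_iff pi_pi)

lemma subspace_carrier: "V.subspace carrier"
  by (rule V.subspaceI) (simp_all add: carrier_iff pi_add pi_scale)

lemma supp_pi: "W.supp (\<pi> v) \<subseteq> deg_rep ` W.supp v"
  by (rule W.supp_image) (rule pi_add pi_degree)+

lemma supp_carrier: "v \<in> carrier \<Longrightarrow> \<alpha> \<in> W.supp v \<Longrightarrow> deg_rep \<alpha> = \<alpha>"
  using supp_pi[of v] by (auto simp: carrier_iff deg_rep_tr)

lemma component_carrier:
  assumes "v \<in> carrier"
  shows "W.component \<alpha> v \<in> carrier"
proof (cases "\<alpha> \<in> W.supp v")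
  case True
  then have "deg_rep \<alpha> = \<alpha>" by (rule supp_carrier[OF assms])
  then show ?thesis using pi_fixed[of _ \<alpha>] by (simp add: carrier_iff)
next
  case False
  then show ?thesis by (simp add: W.in_supp_iff carrier_iff)
qed

lemma component_pi:
  assumes "inj_on deg_rep (insert \<alpha> (W.supp v))"
  shows "W.component (deg_rep \<alpha>) (\<pi> v) = \<pi> (W.component \<alpha> v)"
  by (rule W.component_image_inj[of \<pi> deg_rep, OF pi_add pi_degree assms])

lemma coset_rep_coset: "A \<in> quotient_group degrees \<Longrightarrow> coset_rep A +o degrees = A"
  using deg_rep_coset by (auto simp: quotient_group_def deg_rep_def)

lemma grading_direct_sum:
  "internal_direct_sum scaleW carrier (quotient_group degrees) grading"
proof -
  have "internal_direct_sum scaleW carrier (quotient_group degrees) (\<lambda>A. carrier \<inter> D (coset_rep A))"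
  proof (rule W.internal_direct_sum_reindex)
    show "inj_on coset_rep (quotient_group degrees)"
      by (rule inj_onI) (metis coset_rep_coset)
    show "W.supp v \<subseteq> coset_rep ` quotient_group degrees" if "v \<in> carrier" for v
    proof
      fix \<alpha> assume "\<alpha> \<in> W.supp v"
      then have "\<alpha> = coset_rep (\<alpha> +o degrees)"
        using supp_carrier[OF that] by (simp add: deg_rep_def)
      then show "\<alpha> \<in> coset_rep ` quotient_group degrees"
        by (rule image_eqI) (simp add: quotient_group_def)
    qed
  qed (rule subspace_carrier component_carrier | assumption)+
  then show ?thesis by (simp add: grading_def[abs_def])
qed

lemma action_pi: "action x (\<pi> v) = \<pi> (act x v)"
  by (simp add: action_def pi_act_pi)

lemma carrier_module: "lie_module scaleG bracket scaleW carrier action"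
proof unfold_locales
  show "action (bracket x y) v = action x (action y v) - action y (action x v)"
    if "v \<in> carrier" for v x y
    by (simp add: action_def pi_act_pi act_bracket pi_diff)
qed (simp_all add: subspace_carrier action_def pi_in_carrier pi_add pi_scale act_add act_scale
    add_act scale_act)

text \<open>
  For \<open>x\<close> of degree \<open>\<gamma> \<in> A\<close>, the vector \<open>act x v\<close> has degree \<open>\<gamma> + coset_rep B\<close>, and \<open>\<pi>\<close> carries it to the
  chosen degree of the coset \<open>A + B\<close>.
\<close>

lemma action_degree:
  assumes A: "A \<in> quotient_group degrees" and B: "B \<in> quotient_group degrees"
    and x: "x \<in> coarsened_grading scaleG G A" and v: "v \<in> grading B"
  shows "action x v \<in> grading (A + B)"
proof -
  interpret lie_module scaleG bracket scaleW carrier action by (rule carrier_module)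
  have v_carrier: "v \<in> carrier" and v_D: "v \<in> D (coset_rep B)"
    using v by (simp_all add: grading_def)
  have subspace: "V.subspace (grading (A + B))"
    unfolding grading_def by (intro V.subspace_inter subspace_carrier W.subspace_D)
  show ?thesis
    using x unfolding coarsened_grading_def
  proof (induction x rule: span_induct_alt)
    case base
    have "action 0 v = 0" using act_add_left[OF v_carrier, of 0 0] by simp
    then show ?case using V.subspace_0[OF subspace] by simp
  next
    case (step c x y)
    then obtain \<gamma> where \<gamma>: "\<gamma> \<in> A" "x \<in> G \<gamma>" by blast
    have "\<gamma> +o degrees = A"
    proof -
      obtain \<alpha> where \<alpha>: "A = \<alpha> +o degrees" using A by (auto simp: quotient_group_def)
      then have "\<gamma> - \<alpha> \<in> degrees" using \<gamma>(1) by (auto simp: elt_set_plus_def)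
      then show ?thesis using \<alpha> by (simp add: coset_eq_iff[OF subgroup_degrees])
    qed
    then have "deg_rep (\<gamma> + coset_rep B) = coset_rep (A + B)"
      using coset_add[OF subgroup_degrees, of \<gamma> "coset_rep B"] coset_rep_coset[OF B] by (simp add: deg_rep_def)
    then have "action x v \<in> grading (A + B)"
      using pi_degree[OF act_homogeneous[OF \<gamma>(2) v_D]]
      by (simp add: grading_def action_def pi_in_carrier)
    then show ?case
      using step.IH by (simp add: act_add_left act_scale_left v_carrier
          V.subspace_add[OF subspace] V.subspace_scale[OF subspace])
  qed
qed

lemma carrier_graded:
  "graded_lie_module scaleG bracket scaleW carrier action
     (quotient_group degrees) (coarsened_grading scaleG G) grading"
proof -
  interpret lie_module scaleG bracket scaleW carrier action by (rule carrier_module)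
  show ?thesis
    by unfold_locales (rule grading_direct_sum, rule action_degree)
qed

section \<open>Isomorphism with the loop module\<close>

text \<open>
  The map \<open>w \<mapsto> \<pi> w \<otimes> t\<^sup>\<alpha>\<close> for \<open>w\<close> of degree \<open>\<alpha>\<close>.
\<close>

definition \<sigma> :: "'w \<Rightarrow> ('q \<Rightarrow>\<^sub>0 'w)" where
  "\<sigma> = W.glue (\<lambda>\<alpha> v. Poly_Mapping.single \<alpha> (\<pi> v))"

lemma lookup_sigma: "Poly_Mapping.lookup (\<sigma> v) \<alpha> = \<pi> (W.component \<alpha> v)"
proof -
  have "Poly_Mapping.lookup (\<sigma> v) \<alpha>
      = (\<Sum>\<beta>\<in>W.supp v. if \<beta> = \<alpha> then \<pi> (W.component \<beta> v) else 0)"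
    by (simp add: \<sigma>_def W.glue_def lookup_sum lookup_single when_def)
  then show ?thesis by (simp add: W.in_supp_iff)
qed

lemma keys_sigma: "Poly_Mapping.keys (\<sigma> v) = W.supp v"
  by (auto simp: in_keys_iff lookup_sigma W.in_supp_iff pi_eq_0[OF W.component_in])

lemma sigma_homogeneous: "v \<in> D \<alpha> \<Longrightarrow> \<sigma> v = Poly_Mapping.single \<alpha> (\<pi> v)"
  by (rule poly_mapping_eqI) (simp add: lookup_sigma W.component_homogeneous lookup_single when_def)

lemma sigma_add: "\<sigma> (v + w) = \<sigma> v + \<sigma> w"
  by (rule poly_mapping_eqI) (simp add: lookup_sigma lookup_add W.component_add pi_add)

lemma sigma_scale: "\<sigma> (scaleW c v) = loop_scale scaleW c (\<sigma> v)"
  by (rule poly_mapping_eqI)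
    (simp add: lookup_sigma loop_scale_def Poly_Mapping.map.rep_eq when_def W.component_scale pi_scale)

lemma sigma_act: "\<sigma> (act x v) = loop_act G action x (\<sigma> v)"
proof -
  have sigma_sum: "\<sigma> (sum f A) = (\<Sum>a\<in>A. \<sigma> (f a))" for f :: "'i \<Rightarrow> 'w" and A
    using sigma_add[of 0 0] by (induction A rule: infinite_finite_induct) (simp_all add: sigma_add)
  have act_0: "act 0 v = 0" "act x 0 = 0" for x v
    using add_act[of 0 0 v] act_add[of x 0 0] by simp_all
  have act_sum: "act x (sum f A) = (\<Sum>a\<in>A. act x (f a))" for x and f :: "'i \<Rightarrow> 'w" and A
    by (induction A rule: infinite_finite_induct) (simp_all add: act_add act_0)
  have sum_act: "act (sum f A) v = (\<Sum>a\<in>A. act (f a) v)" for v and f :: "'i \<Rightarrow> 'g" and A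
    by (induction A rule: infinite_finite_induct) (simp_all add: add_act act_0)
  have "act x v = (\<Sum>\<alpha>\<in>G.supp x. \<Sum>\<beta>\<in>W.supp v. act (G.component \<alpha> x) (W.component \<beta> v))"
    by (simp add: W.sum_components G.sum_components flip: act_sum sum_act)
  then have "\<sigma> (act x v) =
      (\<Sum>\<alpha>\<in>G.supp x. \<Sum>\<beta>\<in>W.supp v. \<sigma> (act (G.component \<alpha> x) (W.component \<beta> v)))"
    by (simp add: sigma_sum)
  also have "\<dots> = (\<Sum>\<alpha>\<in>G.supp x. \<Sum>\<beta>\<in>W.supp v.
      Poly_Mapping.single (\<alpha> + \<beta>) (action (G.component \<alpha> x) (\<pi> (W.component \<beta> v))))"
    by (intro sum.cong refl)
      (simp add: sigma_homogeneous[OF act_homogeneous[OF G.component_in W.component_in]] action_pi)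
  also have "\<dots> = loop_act G action x (\<sigma> v)"
    by (simp add: loop_act_def keys_sigma lookup_sigma G.supp_def G.component_def)
  finally show ?thesis .
qed

lemma pi_image: "\<pi> ` D \<alpha> = grading (\<alpha> +o degrees)"
proof
  show "\<pi> ` D \<alpha> \<subseteq> grading (\<alpha> +o degrees)"
    using pi_degree pi_in_carrier by (auto simp: grading_def deg_rep_def)
  show "grading (\<alpha> +o degrees) \<subseteq> \<pi> ` D \<alpha>"
  proof
    fix v assume "v \<in> grading (\<alpha> +o degrees)"
    then have v: "v \<in> D (deg_rep \<alpha>)" "\<pi> v = v" by (simp_all add: grading_def deg_rep_def carrier_iff)
    have "inv (\<theta> \<alpha>) v \<in> D (deg_rep \<alpha> + - (deg_rep \<alpha> - \<alpha>))"
      using hom_homogeneous[OF inv_in_homs[OF theta(2) M_bij[OF theta(1)]] v(1)] .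
    moreover have "\<pi> (inv (\<theta> \<alpha>) v) = v"
      by (simp add: pi_M M_inv theta v)
    ultimately show "v \<in> \<pi> ` D \<alpha>" by (intro image_eqI[of v]) simp_all
  qed
qed

text \<open>
  By \<open>pi_eq_0\<close> and \<open>pi_image\<close> the projection restricts to a bijection from each component of \<open>W\<close> to the
  corresponding component of the quotient.
\<close>

lemma sigma_bij: "bij_betw \<sigma> UNIV (loop_carrier degrees grading)"
proof (rule bij_betwI')
  show "\<sigma> v = \<sigma> w \<longleftrightarrow> v = w" for v w
  proof
    assume eq: "\<sigma> v = \<sigma> w"
    show "v = w"
    proof (rule W.components_eqI)
      fix \<alpha>
      have "\<pi> (W.component \<alpha> v - W.component \<alpha> w) = 0"
        using eq lookup_sigma[of v \<alpha>] lookup_sigma[of w \<alpha>] by (simp add: pi_diff)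
      then show "W.component \<alpha> v = W.component \<alpha> w"
        using pi_eq_0[OF V.subspace_diff[OF W.subspace_D W.component_in W.component_in]] by simp
    qed
  qed simp
  show "\<sigma> v \<in> loop_carrier degrees grading" for v
    by (simp add: loop_carrier_def lookup_sigma flip: pi_image)
  fix f assume "f \<in> loop_carrier degrees grading"
  then have in_image: "Poly_Mapping.lookup f \<alpha> \<in> \<pi> ` D \<alpha>" for \<alpha>
    by (simp add: loop_carrier_def pi_image)
  have "\<forall>\<alpha>. \<exists>v. v \<in> D \<alpha> \<and> Poly_Mapping.lookup f \<alpha> = \<pi> v"
    using in_image by blast
  from choice[OF this] obtain g
    where g: "g \<alpha> \<in> D \<alpha>" "Poly_Mapping.lookup f \<alpha> = \<pi> (g \<alpha>)" for \<alpha>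
    by blast
  have "f = \<sigma> (\<Sum>\<alpha>\<in>Poly_Mapping.keys f. g \<alpha>)"
    by (rule poly_mapping_eqI)
      (simp add: lookup_sigma W.component_sum_homogeneous g(1) in_keys_iff flip: g(2))
  then show "\<exists>v\<in>UNIV. f = \<sigma> v" by blast
qed

lemma isomorphic_loop_module:
  "graded_isomorphic scaleW UNIV act D
     (loop_scale scaleW) (loop_carrier degrees grading) (loop_act G action) (loop_grading degrees grading)"
  unfolding graded_isomorphic_def lie_module_isomorphism_def
proof (intro exI[of _ 0] exI[of _ \<sigma>] conjI allI ballI)
  fix \<alpha>
  have "\<sigma> ` D \<alpha> = Poly_Mapping.single \<alpha> ` \<pi> ` D \<alpha>"
    unfolding image_image by (rule image_cong) (simp_all add: sigma_homogeneous)
  then show "\<sigma> ` D \<alpha> = loop_grading degrees grading (\<alpha> + 0)"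
    by (simp add: loop_grading_def pi_image)
qed (simp_all add: sigma_bij sigma_add sigma_scale sigma_act)

end

section \<open>Simplicity by vectors of minimal support\<close>

context maximal_commuting_family
begin

text \<open>
  The vectors of \<open>W\<close> with class in \<open>N\<close> and support in the translate of \<open>S\<close> by \<open>\<beta>\<close>. Working in \<open>W\<close>
  and not in the quotient lets \<open>\<beta>\<close> range over \<open>Q\<close>, so the maps constructed from these
  spaces have degrees in \<open>Q\<close>.
\<close>

definition window :: "'w set \<Rightarrow> 'q set \<Rightarrow> 'q \<Rightarrow> 'w set" where
  "window N S \<beta> = {n. \<pi> n \<in> N \<and> W.supp n \<subseteq> (+) \<beta> ` S}"

context
  fixes N :: "'w set"
  assumes N: "lie_submodule scaleW carrier action N"
begin

lemma subspace_N: "V.subspace N"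
  and N_carrier: "n \<in> N \<Longrightarrow> n \<in> carrier"
  and N_action: "n \<in> N \<Longrightarrow> action x n \<in> N"
  using N by (auto simp: lie_submodule_def)

lemma window_add: "m \<in> window N S \<beta> \<Longrightarrow> n \<in> window N S \<beta> \<Longrightarrow> m + n \<in> window N S \<beta>"
  using W.supp_add[of m n] by (auto simp: window_def pi_add V.subspace_add[OF subspace_N])

lemma window_scale: "n \<in> window N S \<beta> \<Longrightarrow> scaleW c n \<in> window N S \<beta>"
  using W.supp_scale[of c n] by (auto simp: window_def pi_scale V.subspace_scale[OF subspace_N])

lemma window_0: "0 \<in> window N S \<beta>"
  by (auto simp: window_def V.subspace_0[OF subspace_N] W.in_supp_iff)

lemma window_diff: "m \<in> window N S \<beta> \<Longrightarrow> n \<in> window N S \<beta> \<Longrightarrow> m - n \<in> window N S \<beta>"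
  using window_add[of m S \<beta> "scaleW (- 1) n"] window_scale[of n S \<beta> "- 1"] by simp

lemma window_act:
  assumes "x \<in> G \<gamma>" "n \<in> window N S \<beta>"
  shows "act x n \<in> window N S (\<gamma> + \<beta>)"
proof -
  have "W.supp (act x n) \<subseteq> (+) \<gamma> ` W.supp n"
    by (rule W.supp_image) (rule act_add act_homogeneous[OF assms(1)] | assumption)+
  moreover have "\<pi> (act x n) \<in> N"
    using assms(2) N_action[of "\<pi> n" x] by (simp add: window_def action_pi)
  ultimately show ?thesis
    using assms(2) by (force simp: window_def add.assoc)
qed

lemma window_M:
  assumes "u \<in> M" "u \<in> homs \<gamma>" "n \<in> window N S \<beta>"
  shows "u n \<in> window N S (\<beta> + \<gamma>)"
proof -
  have "W.supp (u n) \<subseteq> (\<lambda>\<alpha>. \<alpha> + \<gamma>) ` W.supp n"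
    by (rule W.supp_image) (rule hom_add[OF assms(2)] hom_homogeneous[OF assms(2)] | assumption)+
  then show ?thesis
    using assms(1,3) by (force simp: window_def pi_M algebra_simps)
qed

context
  fixes S :: "'q set" and s :: 'q and v :: 'w
  assumes leading: "\<And>\<beta> n. n \<in> window N S \<beta> \<Longrightarrow> W.component (\<beta> + s) n = 0 \<Longrightarrow> n = 0"
    and nonzero: "v \<in> window N S 0" "v \<noteq> 0"
begin

lemma window_eqI:
  assumes "m \<in> window N S \<beta>" "n \<in> window N S \<beta>"
    and "W.component (\<beta> + s) m = W.component (\<beta> + s) n"
  shows "m = n"
proof -
  have "W.component (\<beta> + s) (m - n) = 0"
    using W.component_add[of "\<beta> + s" "m - n" n] assms(3) by simp
  then show ?thesis
    using leading[OF window_diff[OF assms(1,2)]] by simp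
qed

text \<open>
  The possible components at \<open>\<beta> + s\<close> of vectors in \<open>window N S \<beta>\<close>, for all \<open>\<beta>\<close>, span a nonzero graded
  submodule \<open>U\<close> of \<open>W\<close>, which is therefore all of \<open>W\<close>.
\<close>

lemma window_lift: "\<exists>n\<in>window N S (\<alpha> - s). W.component \<alpha> n = W.component \<alpha> w"
proof -
  define U where "U = {w. \<forall>\<alpha>. \<exists>n\<in>window N S (\<alpha> - s). W.component \<alpha> n = W.component \<alpha> w}"
  have UI: "w \<in> U" if "\<And>\<alpha>. \<exists>n\<in>window N S (\<alpha> - s). W.component \<alpha> n = W.component \<alpha> w" for w
    using that by (simp add: U_def)
  have UE: "\<exists>n\<in>window N S (\<alpha> - s). W.component \<alpha> n = W.component \<alpha> w" if "w \<in> U" for w \<alpha>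
    using that by (simp add: U_def)
  have subspace_U: "V.subspace U"
  proof (rule V.subspaceI)
    show "0 \<in> U" by (rule UI) (use window_0 in force)
    show "x + y \<in> U" if "x \<in> U" "y \<in> U" for x y
      by (rule UI) (metis UE[OF that(1)] UE[OF that(2)] window_add W.component_add)
    show "scaleW c x \<in> U" if "x \<in> U" for c x
      by (rule UI) (metis UE[OF that] window_scale W.component_scale)
  qed
  have component_U: "W.component \<alpha> w \<in> U" if "w \<in> U" for \<alpha> w
  proof (rule UI)
    fix \<beta>
    show "\<exists>n\<in>window N S (\<beta> - s). W.component \<beta> n = W.component \<beta> (W.component \<alpha> w)"
    proof (cases "\<beta> = \<alpha>")
      case True
      then show ?thesis
        using UE[OF that, of \<alpha>] by (simp add: W.component_homogeneous[OF W.component_in])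
    next
      case False
      then show ?thesis
        by (intro bexI[of _ 0] window_0) (simp add: W.component_homogeneous[OF W.component_in])
    qed
  qed
  have "U = {0} \<or> U = UNIV"
  proof (rule graded_subspace_trivial[OF subspace_U _ component_U])
    fix x w assume "w \<in> U"
    then show "act x w \<in> U"
    proof (induction x rule: G.homogeneous_induct)
      case (homogeneous \<gamma> x)
      show ?case
      proof (rule UI)
        fix \<alpha>
        obtain n where n: "n \<in> window N S (\<alpha> - \<gamma> - s)" "W.component (\<alpha> - \<gamma>) n = W.component (\<alpha> - \<gamma>) w"
          using UE[OF \<open>w \<in> U\<close>] by blast
        have "act x n \<in> window N S (\<alpha> - s)"
          using window_act[OF homogeneous(1) n(1)] by (simp add: algebra_simps)
        moreover have "W.component \<alpha> (act x n) = W.component \<alpha> (act x w)"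
          using component_act[OF homogeneous(1), of "\<alpha> - \<gamma>"] n(2) by simp
        ultimately show "\<exists>n\<in>window N S (\<alpha> - s). W.component \<alpha> n = W.component \<alpha> (act x w)" by blast
      qed
    qed (simp add: add_act V.subspace_add[OF subspace_U])
  qed
  moreover have "U \<noteq> {0}"
  proof -
    have "W.component s v \<in> U"
    proof (rule UI)
      fix \<beta>
      show "\<exists>n\<in>window N S (\<beta> - s). W.component \<beta> n = W.component \<beta> (W.component s v)"
      proof (cases "\<beta> = s")
        case True
        then show ?thesis
          using nonzero(1) by (intro bexI[of _ v]) (simp_all add: W.component_homogeneous[OF W.component_in])
      next
        case False
        then show ?thesis
          by (intro bexI[of _ 0] window_0) (simp add: W.component_homogeneous[OF W.component_in])
      qed
    qed
    moreover have "W.component s v \<noteq> 0"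
      using leading[OF nonzero(1)] nonzero(2) by auto
    ultimately show ?thesis by blast
  qed
  ultimately show ?thesis using UE by blast
qed

text \<open>
  Every homogeneous vector \<open>w\<close> of degree \<open>\<alpha>\<close> has exactly one lift to \<open>window N S (\<alpha> - s)\<close>, and \<open>\<phi>\<close>
  maps \<open>w\<close> to the component of this lift at \<open>\<alpha> - s + s'\<close>. The characterisation of \<open>\<phi>\<close> by vectors of the
  windows yields its compatibility with scalars, the Lie algebra and \<open>M\<close>, because all of them
  map windows to windows.
\<close>

lemma window_transition:
  obtains \<phi> where "\<phi> \<in> homs (s' - s)" "\<And>u w. u \<in> M \<Longrightarrow> u (\<phi> w) = \<phi> (u w)"
    "\<And>n \<beta>. n \<in> window N S \<beta> \<Longrightarrow> \<phi> (W.component (\<beta> + s) n) = W.component (\<beta> + s') n"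
proof -
  define lift where "lift \<alpha> w = (SOME n. n \<in> window N S (\<alpha> - s) \<and> W.component \<alpha> n = w)" for \<alpha> w
  have lift: "lift \<alpha> w \<in> window N S (\<alpha> - s)" "W.component \<alpha> (lift \<alpha> w) = w"
    if "w \<in> D \<alpha>" for \<alpha> w
  proof -
    have "\<exists>n. n \<in> window N S (\<alpha> - s) \<and> W.component \<alpha> n = w"
      using window_lift[of \<alpha> w] W.component_homogeneous[OF that, of \<alpha>] by auto
    from someI_ex[OF this] show "lift \<alpha> w \<in> window N S (\<alpha> - s)" "W.component \<alpha> (lift \<alpha> w) = w"
      by (simp_all add: lift_def)
  qed
  have lift_eqI: "lift \<alpha> w = n" if "n \<in> window N S (\<alpha> - s)" "W.component \<alpha> n = w" "w \<in> D \<alpha>" for \<alpha> w n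
    by (rule window_eqI[OF lift(1)[OF that(3)] that(1)]) (simp add: lift(2)[OF that(3)] that(2))
  define f where "f \<alpha> w = W.component (\<alpha> - s + s') (lift \<alpha> w)" for \<alpha> w
  define \<phi> where "\<phi> = W.glue f"
  have f_add: "f \<alpha> (x + y) = f \<alpha> x + f \<alpha> y" if "x \<in> D \<alpha>" "y \<in> D \<alpha>" for \<alpha> x y
  proof -
    have "lift \<alpha> (x + y) = lift \<alpha> x + lift \<alpha> y"
      by (rule lift_eqI)
        (simp_all add: window_add lift that W.component_add V.subspace_add[OF W.subspace_D])
    then show ?thesis by (simp add: f_def W.component_add)
  qed
  have phi_add: "\<phi> (x + y) = \<phi> x + \<phi> y" for x y
    unfolding \<phi>_def using f_add by (rule W.glue_add)
  have f_0: "f \<alpha> 0 = 0" for \<alpha>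
    using f_add[of 0 \<alpha> 0] V.subspace_0[OF W.subspace_D] by simp
  have phi: "\<phi> (W.component (\<beta> + s) n) = W.component (\<beta> + s') n" if "n \<in> window N S \<beta>" for n \<beta>
  proof -
    have "lift (\<beta> + s) (W.component (\<beta> + s) n) = n"
      by (rule lift_eqI) (simp_all add: that)
    then show ?thesis
      unfolding \<phi>_def using W.glue_homogeneous[of f, OF f_0 W.component_in] by (simp add: f_def)
  qed
  have lifted: "\<exists>n\<in>window N S (\<alpha> - s). w = W.component (\<alpha> - s + s) n" if "w \<in> D \<alpha>" for \<alpha> w
    using lift[OF that] by force
  have "\<phi> \<in> homs (s' - s)"
  proof (rule homsI)
    show "\<phi> (scaleW c w) = scaleW c (\<phi> w)" for c w
    proof (induction w rule: W.homogeneous_induct)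
      case (homogeneous \<alpha> w)
      then obtain n where n: "n \<in> window N S (\<alpha> - s)" "w = W.component (\<alpha> - s + s) n"
        using lifted by blast
      show ?case
        unfolding n(2) phi[OF n(1)] W.component_scale[symmetric]
        by (rule phi[OF window_scale[OF n(1)]])
    qed (simp add: phi_add V.scale_right_distrib)
    show "\<phi> (act x w) = act x (\<phi> w)" for x w
    proof (induction x rule: G.homogeneous_induct)
      case (homogeneous \<gamma> x)
      show ?case
      proof (induction w rule: W.homogeneous_induct)
        case w: (homogeneous \<alpha> w)
        then obtain n where n: "n \<in> window N S (\<alpha> - s)" "w = W.component (\<alpha> - s + s) n"
          using lifted by blast
        have "\<phi> (act x w) = \<phi> (W.component (\<gamma> + (\<alpha> - s) + s) (act x n))"
          using component_act[OF homogeneous, of "\<alpha> - s + s" n] by (simp only: n(2) add.assoc)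
        also have "\<dots> = W.component (\<gamma> + (\<alpha> - s) + s') (act x n)"
          by (rule phi[OF window_act[OF homogeneous n(1)]])
        also have "\<dots> = act x (\<phi> w)"
          using component_act[OF homogeneous, of "\<alpha> - s + s'" n] by (simp only: n(2) phi[OF n(1)] add.assoc)
        finally show ?case .
      qed (simp add: act_add phi_add)
    qed (simp add: add_act phi_add)
    show "\<phi> w \<in> D (\<alpha> + (s' - s))" if w: "w \<in> D \<alpha>" for \<alpha> w
    proof -
      obtain n where n: "n \<in> window N S (\<alpha> - s)" "w = W.component (\<alpha> - s + s) n"
        using lifted[OF w] by blast
      have "\<alpha> + (s' - s) = \<alpha> - s + s'" by (simp add: algebra_simps)
      then show ?thesis unfolding n(2) phi[OF n(1)] by (simp only: W.component_in)
    qed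
  qed (rule phi_add)
  moreover have "u (\<phi> w) = \<phi> (u w)" if u: "u \<in> M" for u w
  proof -
    obtain \<gamma> where \<gamma>: "u \<in> homs \<gamma>" using M_hom[OF u] by blast
    show ?thesis
    proof (induction w rule: W.homogeneous_induct)
      case (homogeneous \<alpha> w)
      then obtain n where n: "n \<in> window N S (\<alpha> - s)" "w = W.component (\<alpha> - s + s) n"
        using lifted by blast
      have move: "W.component (\<alpha> - s + \<gamma> + \<beta>) (u n) = u (W.component (\<alpha> - s + \<beta>) n)" for \<beta>
        using component_hom[OF \<gamma>, of "\<alpha> - s + \<beta>" n] by (simp add: algebra_simps)
      show ?case
        using phi[OF window_M[OF u \<gamma> n(1)]] by (simp only: move n(2) phi[OF n(1)])
    qed (simp add: phi_add M_add[OF u])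
  qed
  ultimately show thesis using phi by (rule that)
qed

end

text \<open>
  A nonzero vector of \<open>N\<close> with support \<open>S\<close> of minimal size satisfies \<open>leading\<close> for every \<open>s\<close> in \<open>S\<close>:
  if one component of a vector in a window vanishes, its image under \<open>\<pi>\<close> has smaller support, hence is
  \<open>0\<close>. The vector itself then vanishes too, as distinct degrees in a translate of \<open>S\<close> lie in distinct
  cosets. So \<open>window_transition\<close> applies and excludes a second degree in \<open>S\<close>; with a single degree, the
  window at \<open>\<alpha> - s\<close> is the whole component of degree \<open>\<alpha>\<close>.
\<close>

lemma N_trivial: "N = {0} \<or> N = carrier"
proof (rule disjCI)
  assume "N \<noteq> carrier"
  show "N = {0}"
  proof (rule ccontr)
    assume "N \<noteq> {0}"
    then have "\<exists>v. v \<in> N \<and> v \<noteq> 0" using V.subspace_0[OF subspace_N] by blast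
    then obtain v where v: "v \<in> N" "v \<noteq> 0"
      and minimal: "\<And>w. w \<in> N \<Longrightarrow> w \<noteq> 0 \<Longrightarrow> card (W.supp v) \<le> card (W.supp w)"
      using ex_has_least_nat[of "\<lambda>v. v \<in> N \<and> v \<noteq> 0" _ "\<lambda>v. card (W.supp v)"] by blast
    define S where "S = W.supp v"
    have S_deg_rep: "deg_rep \<alpha> = \<alpha>" if "\<alpha> \<in> S" for \<alpha>
      using supp_carrier[OF N_carrier[OF v(1)]] that by (simp add: S_def)
    have inj_window: "inj_on deg_rep ((+) \<beta> ` S)" for \<beta>
    proof (rule inj_onI)
      fix a b assume "a \<in> (+) \<beta> ` S" "b \<in> (+) \<beta> ` S" "deg_rep a = deg_rep b"
      then obtain a' b' where ab: "a = \<beta> + a'" "b = \<beta> + b'" "a' \<in> S" "b' \<in> S" by blast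
      then have "deg_rep a' = deg_rep b'" using \<open>deg_rep a = deg_rep b\<close> by (simp add: deg_rep_eq_iff)
      then show "a = b" using ab by (simp add: S_deg_rep)
    qed
    have leading: "n = 0" if n: "n \<in> window N S \<beta>" and "W.component (\<beta> + s) n = 0" and "s \<in> S" for \<beta> n s
    proof -
      have supp: "W.supp n \<subseteq> (+) \<beta> ` (S - {s})"
      proof
        fix \<alpha> assume \<alpha>: "\<alpha> \<in> W.supp n"
        then obtain a where "a \<in> S" "\<alpha> = \<beta> + a" using n by (auto simp: window_def)
        moreover have "a \<noteq> s" using \<alpha> that(2) calculation(2) by (auto simp: W.in_supp_iff)
        ultimately show "\<alpha> \<in> (+) \<beta> ` (S - {s})" by blast
      qed
      have "card (W.supp (\<pi> n)) \<le> card (deg_rep ` (+) \<beta> ` (S - {s}))"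
        using subset_trans[OF supp_pi image_mono[OF supp]] by (intro card_mono) (simp_all add: S_def)
      also have "\<dots> \<le> card (S - {s})"
        unfolding image_image by (rule card_image_le) (simp add: S_def)
      also have "\<dots> < card S"
        using \<open>s \<in> S\<close> by (intro psubset_card_mono) (auto simp: S_def)
      finally have "\<pi> n = 0"
        using minimal[of "\<pi> n"] n by (force simp: window_def S_def)
      have "W.supp n = {}"
      proof (rule ccontr)
        assume "W.supp n \<noteq> {}"
        then obtain \<alpha> where \<alpha>: "\<alpha> \<in> W.supp n" by blast
        have "inj_on deg_rep (insert \<alpha> (W.supp n))"
          using \<alpha> n inj_window[of \<beta>] by (auto simp: insert_absorb window_def intro: inj_on_subset)
        then have "\<pi> (W.component \<alpha> n) = 0"
          using component_pi[of \<alpha> n] \<open>\<pi> n = 0\<close> by simp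
        then show False
          using \<alpha> pi_eq_0[OF W.component_in] by (simp add: W.in_supp_iff)
      qed
      then show ?thesis by (simp add: W.supp_empty_iff)
    qed
    have v_window: "v \<in> window N S 0"
      using v N_carrier by (simp add: window_def S_def carrier_iff)
    obtain s where s: "s \<in> S" using v(2) W.supp_empty_iff[of v] by (auto simp: S_def)
    have "S = {s}"
    proof (rule ccontr)
      assume "S \<noteq> {s}"
      then obtain s' where s': "s' \<in> S" "s' \<noteq> s" using s by blast
      obtain \<phi> where \<phi>: "\<phi> \<in> homs (s' - s)" "\<And>u w. u \<in> M \<Longrightarrow> u (\<phi> w) = \<phi> (u w)"
        "\<And>n \<beta>. n \<in> window N S \<beta> \<Longrightarrow> \<phi> (W.component (\<beta> + s) n) = W.component (\<beta> + s') n"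
        using window_transition[of S s v s'] leading[OF _ _ s] v_window v(2) by metis
      have "\<phi> (W.component s v) = W.component s' v"
        using \<phi>(3)[OF v_window] by simp
      then have "\<phi> \<noteq> (\<lambda>_. 0)"
        using s' by (auto simp: S_def W.in_supp_iff)
      then have "s' - s \<in> degrees"
        using degree_of_commuting_hom[OF \<phi>(1) _ \<phi>(2)] by blast
      then have "deg_rep s' = deg_rep s" by (simp add: deg_rep_eq_iff)
      then show False using s s' by (simp add: S_deg_rep)
    qed
    have "\<pi> w \<in> N" for w
    proof (induction w rule: W.homogeneous_induct)
      case (homogeneous \<alpha> w)
      obtain n where n: "n \<in> window N S (\<alpha> - s)" "W.component \<alpha> n = W.component \<alpha> w"
        using window_lift[of S s v \<alpha> w] leading[OF _ _ s] v_window v(2) by metis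
      have "W.component \<beta> n = W.component \<beta> w" for \<beta>
        using n W.component_homogeneous[OF homogeneous, of \<beta>]
        by (cases "\<beta> = \<alpha>") (auto simp: window_def \<open>S = {s}\<close> W.in_supp_iff subset_iff)
      then have "n = w" by (rule W.components_eqI)
      then show ?case using n(1) by (simp add: window_def)
    qed (simp add: pi_add V.subspace_add[OF subspace_N])
    then have "carrier \<subseteq> N" by (metis carrier_iff subsetI)
    then show False using \<open>N \<noteq> carrier\<close> N_carrier by blast
  qed
qed

end

text \<open>
  If the action on the quotient vanished, then so would \<open>\<pi> (act x w)\<close> for homogeneous \<open>x\<close> and \<open>w\<close>, and
  \<open>\<pi>\<close> is injective on homogeneous vectors.
\<close>

lemma carrier_simple: "simple_lie_module scaleG bracket scaleW carrier action"
proof -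
  interpret carrier: lie_module scaleG bracket scaleW carrier action by (rule carrier_module)
  have "\<exists>x. \<exists>v\<in>carrier. action x v \<noteq> 0"
  proof (rule ccontr)
    assume "\<not> ?thesis"
    then have zero: "\<pi> (act x w) = 0" for x w
      using pi_in_carrier[of w] action_pi[of x w] by metis
    have act_0: "act x w = 0" for x w
    proof (induction x rule: G.homogeneous_induct)
      case (homogeneous \<gamma> x)
      show ?case
      proof (induction w rule: W.homogeneous_induct)
        case w: (homogeneous \<alpha> w)
        show ?case using pi_eq_0[OF act_homogeneous[OF homogeneous w]] zero by simp
      qed (simp add: act_add)
    qed (simp add: add_act)
    then show False using act_nontrivial by simp
  qed
  then show ?thesis
    by unfold_locales (simp_all add: N_trivial)
qed

end

theorem theorem31:
  fixes scaleG :: "'k::alg_closed_field \<Rightarrow> 'g::ab_group_add \<Rightarrow> 'g"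
    and bracket :: "'g \<Rightarrow> 'g \<Rightarrow> 'g"
    and G :: "'q::ab_group_add \<Rightarrow> 'g set"
    and scaleW :: "'k \<Rightarrow> 'w::ab_group_add \<Rightarrow> 'w"
    and actW :: "'g \<Rightarrow> 'w \<Rightarrow> 'w"
    and DW :: "'q \<Rightarrow> 'w set"
  assumes "graded_lie_algebra scaleG bracket UNIV G"
    and "graded_simple_lie_module scaleG bracket scaleW UNIV actW UNIV G DW"
    and "cardinal_dim scaleW <o |UNIV :: 'k set|"
  shows "\<exists>(P :: 'q set) (scaleV :: 'k \<Rightarrow> 'w \<Rightarrow> 'w) (V :: 'w set) actV (DV :: 'q set \<Rightarrow> 'w set).
    is_subgroup P \<and>
    simple_lie_module scaleG bracket scaleV V actV \<and>
    graded_lie_module scaleG bracket scaleV V actV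
      (quotient_group P) (coarsened_grading scaleG G) DV \<and>
    graded_isomorphic scaleW UNIV actW DW
      (loop_scale scaleV) (loop_carrier P DV) (loop_act G actV) (loop_grading P DV)"
proof -
  interpret small_graded_simple_module scaleG bracket G scaleW actW DW
    by (intro small_graded_simple_module.intro graded_simple_module.intro
        small_graded_simple_module_axioms.intro assms)
  obtain M where "M \<in> commuting_families" "\<forall>X\<in>commuting_families. M \<subseteq> X \<longrightarrow> X = M"
    using maximal_family_exists by blast
  then interpret maximal_commuting_family scaleG bracket G scaleW actW DW M
    by unfold_locales auto
  show ?thesis
    using subgroup_degrees carrier_simple carrier_graded isomorphic_loop_module by blast
qed

end
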